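(* Consider any solution to the colored predecessor problem on a set of $n$ integers of $\ell$ bits each which uses space $n\cdot 2^a$ cells in the cell-probe model with cells of $w$ bits, and whose (possibly randomized) query algorithm has error probability at most $\frac13$. If $a = \Omega(\lg n)$, then the query time $T$ (number of cell probes) satisfies \[ T = \Omega\left( \min\left\{ \log_w n,\; \frac{\lg(\ell/a)}{\lg\lg(\ell/a) + \lg(a/\lg n)} \right\}\right). \]
   Context: $\lg x = \lceil \log_2(x+2)\rceil$. Colored predecessor problem: the data is a set $Y$ of $n$ integers of $\ell$ bits each, each colored red or blue; a query $x$ asks for the color of $\max\{y\in Y\mid y\le x\}$. Cell-probe model: the data is stored in a table of $w$-bit cells depending arbitrarily on the data; the query cost is the number of cells read, computation is free. It is assumed $\lg n\le \ell\le w$ and $w=\Omega(\lg n)$. *)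

theory Defs
  imports "HOL-Probability.Probability"
begin

definition lg :: "real \<Rightarrow> real" where
  "lg x = of_int \<lceil>log 2 (x + 2)\<rceil>"

datatype color = Red | Blue

text \<open>
  A colored set is a partial map: its domain is the set \<open>Y\<close>, its values are the colors.
  Integers of \<open>l\<close> bits are the natural numbers below \<open>2 ^ l\<close>.
\<close>

definition colored_sets :: "nat \<Rightarrow> nat \<Rightarrow> (nat \<rightharpoonup> color) set" where
  "colored_sets n l = {Y. dom Y \<subseteq> {..<2 ^ l} \<and> card (dom Y) = n}"

text \<open>Only meaningful if \<open>x\<close> has a predecessor in \<open>dom Y\<close>.\<close>

definition pred_color :: "(nat \<rightharpoonup> color) \<Rightarrow> nat \<Rightarrow> color" where
  "pred_color Y x = the (Y (Max {y \<in> dom Y. y \<le> x}))"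

text \<open>
  Since computation is free, a deterministic query algorithm (for a fixed query) is a decision
  tree: \<open>Probe i f\<close> reads cell \<open>i\<close> and continues with \<open>f v\<close>, where \<open>v\<close> is the content of the cell.
\<close>

datatype probe_tree = Answer color | Probe nat "nat \<Rightarrow> probe_tree"

primrec result :: "probe_tree \<Rightarrow> (nat \<Rightarrow> nat) \<Rightarrow> color" where
  "result (Answer c) M = c"
| "result (Probe i f) M = result (f (M i)) M"

primrec probes :: "probe_tree \<Rightarrow> (nat \<Rightarrow> nat) \<Rightarrow> nat list" where
  "probes (Answer c) M = []"
| "probes (Probe i f) M = i # probes (f (M i)) M"

text \<open>
  \<open>D Y\<close> is the table of \<open>S\<close> cells of \<open>w\<close> bits stored for \<open>Y\<close> (entries at indices \<open>\<ge> S\<close> are never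
  read). \<open>Q x\<close> is the randomized algorithm for the query \<open>x\<close>, a distribution over decision trees;
  its random choices do not influence the table. The bound \<open>T\<close> on the number of probes is
  worst-case, over the random choices as well. Nothing is required of the answer to a query
  without predecessor, but its probes are subject to the same bounds.
\<close>

definition solves_colored_predecessor ::
  "nat \<Rightarrow> nat \<Rightarrow> nat \<Rightarrow> nat \<Rightarrow> nat \<Rightarrow> ((nat \<rightharpoonup> color) \<Rightarrow> nat \<Rightarrow> nat) \<Rightarrow> (nat \<Rightarrow> probe_tree pmf) \<Rightarrow> bool"
where
  "solves_colored_predecessor n l w S T D Q \<longleftrightarrow>
    (\<forall>Y \<in> colored_sets n l.
      (\<forall>i<S. D Y i < 2 ^ w) \<and>
      (\<forall>x < 2 ^ l.
        (\<forall>q \<in> set_pmf (Q x). set (probes q (D Y)) \<subseteq> {..<S} \<and> length (probes q (D Y)) \<le> T) \<and>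
        ((\<exists>y \<in> dom Y. y \<le> x) \<longrightarrow>
          measure_pmf.prob (Q x) {q. result q (D Y) \<noteq> pred_color Y x} \<le> 1 / 3)))"

end

theory Submission
  imports Defs
begin

text \<open>
  The proof is by round elimination with published bits, on a distribution of instances that is
  built recursively. From a hard problem without published bits one forms \<open>K\<close> independent blocks, of
  which the query selects one: published bits that are few compared to \<open>K\<close> say almost nothing about
  an average block. Then queries become strings of \<open>k\<close> digits, and the keys share a random prefix of a
  random length \<open>i\<close>. Along a random query string the entropy of the first probed cell decreases
  from at most \<open>ln S\<close> to \<open>0\<close>, so for average \<open>i\<close> the digit at position \<open>i\<close> reveals only about
  \<open>(ln S) / k\<close> about that cell. Hence a moderate number \<open>N\<close> of published cells, chosen by
  rejection sampling, makes the first probe free.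

  Each of the \<open>T\<close> rounds costs an error of \<open>O(1 / T)\<close> with a small constant, and the trivial
  problem of one key with a random color has error \<open>1 / 2\<close>, so that the error of \<open>1 / 3\<close> needs no
  amplification. Since \<open>N\<close> may be as large as \<open>n powr (1 / O(T))\<close>, it suffices to take \<open>k\<close> of order
  \<open>T\<^sup>2 * a / lg n\<close>, and the construction fits into \<open>l\<close> bits as long as \<open>(2 * k) ^ T * a\<close> is at most
  of order \<open>l\<close>.
\<close>

section \<open>Divergence and sampling\<close>

text \<open>The published cells must be fixed before the query digit is known. They are therefore
  drawn from the distribution of the first cell given the prefix alone; rejection turns one of them
  into a sample given the digit as well, as long as the second distribution is at most
  \<open>R\<close> times the first, and about \<open>R * T\<close> samples suffice. Mass beyond this
  factor costs at least \<open>ln R - 1\<close> units of divergence per unit of mass. So information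
  \<open>(ln S) / k\<close> about the cell causes an error of only about
  \<open>(ln S) / (k * ln R)\<close>, and with \<open>R = n powr (1 / (4 * T))\<close> an error of
  order \<open>1 / T\<close> needs \<open>k\<close> of order
  \<open>T\<^sup>2 * (ln S) / ln n\<close>. The two constructions pay in different currencies.
  Prefixes save a probe, multiply the length of the keys by \<open>k\<close> and leave
  \<open>N\<close> published cells. Blocks remove the publication and multiply the number of keys by
  \<open>K\<close>, of order \<open>N * w * T\<^sup>2\<close>. The demand
  \<open>K ^ T \<le> n\<close> leads to the term \<open>log w n\<close> of the minimum, the demand
  on the length to the other term.\<close>

text \<open>The correction \<open>- a + b\<close> makes every term of a divergence nonnegative and
  cancels when summed over two distributions. Where \<open>a\<close> exceeds \<open>R * b\<close>,
  the logarithm is at least \<open>ln R\<close>, so the term is at least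
  \<open>(ln R - 1) * a\<close>.\<close>

lemma kl_above:
  fixes a b R :: real
  assumes "0 \<le> a" "0 \<le> b" "b = 0 \<Longrightarrow> a = 0" "R > 0" "1 \<le> ln R"
  shows "(ln R - 1) * max 0 (a - R * b) \<le> a * ln (a / b) - a + b"
proof (cases "a = 0")
  case True
  then show ?thesis using assms by simp
next
  case False
  then have pos: "a > 0" "b > 0" using assms by (auto simp: order_less_le)
  show ?thesis
  proof (cases "a \<le> R * b")
    case True
    have "ln (b / a) \<le> b / a - 1" using pos by (intro ln_le_minus_one) auto
    then have "- ln (a / b) \<le> b / a - 1" using pos by (simp add: ln_div)
    then have "a * (- ln (a / b)) \<le> a * (b / a - 1)" using pos by (intro mult_left_mono) auto
    then show ?thesis using True pos by (simp add: algebra_simps)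
  next
    case False
    then have "R \<le> a / b" using pos by (simp add: field_simps)
    then have "ln R \<le> ln (a / b)" using assms by simp
    then have "a * ln R \<le> a * ln (a / b)" using pos by simp
    moreover have "(ln R - 1) * max 0 (a - R * b) \<le> (ln R - 1) * a"
      using assms pos by (intro mult_left_mono) auto
    moreover have "(ln R - 1) * a = a * ln R - a" by (simp add: algebra_simps)
    ultimately show ?thesis using assms by linarith
  qed
qed

text \<open>Each divergence term is at least the Hellinger term
  \<open>(sqrt b - sqrt a)\<^sup>2\<close>; the remaining product with \<tau> is split by the
  inequality of arithmetic and geometric means. Scaling to \<open>b = 1\<close> leaves the single
  variable \<open>g = sqrt (a / b)\<close>.\<close>

lemma kl_below:
  fixes a b \<tau> :: real
  assumes "0 \<le> a" "0 < b" "0 \<le> \<tau>"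
  shows "\<tau> * max 0 (b - a) \<le> a * ln (a / b) - a + b + \<tau>\<^sup>2 * b"
proof -
  define g where "g = sqrt (a / b)"
  have g: "g \<ge> 0" "g\<^sup>2 = a / b" using assms by (auto simp: g_def)
  have a: "a = g\<^sup>2 * b" using g assms by simp
  have main: "\<tau> * max 0 (1 - g\<^sup>2) \<le> g\<^sup>2 * ln (g\<^sup>2) - g\<^sup>2 + 1 + \<tau>\<^sup>2"
  proof -
    \<comment> \<open>The bound \<open>ln g \<ge> 1 - 1 / g\<close> is taken at \<open>g\<close> and
      doubled. Taken at \<open>g\<^sup>2\<close>, it would give no more than nonnegativity of the
      divergence term.\<close>
    have 1: "2 * g\<^sup>2 - 2 * g \<le> g\<^sup>2 * ln (g\<^sup>2)"
    proof (cases "g = 0")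
      case False
      then have gp: "g > 0" using g by simp
      have "ln (1 / g) \<le> 1 / g - 1" using gp by (intro ln_le_minus_one) auto
      then have "1 - 1 / g \<le> ln g" using gp by (simp add: ln_div)
      then have "g\<^sup>2 * 2 * (1 - 1 / g) \<le> g\<^sup>2 * 2 * ln g" using gp by (intro mult_left_mono) auto
      moreover have "g\<^sup>2 * 2 * (1 - 1 / g) = 2 * g\<^sup>2 - 2 * g"
        using gp by (simp add: field_simps power2_eq_square)
      ultimately show ?thesis using gp by (simp add: ln_realpow)
    qed simp
    have 2: "(1 - g)\<^sup>2 \<le> g\<^sup>2 * ln (g\<^sup>2) - g\<^sup>2 + 1"
      using 1 by (simp add: power2_eq_square algebra_simps)
    show ?thesis
    proof (cases "g \<le> 1")
      case True
      have "\<tau> * (1 - g\<^sup>2) = \<tau> * (1 - g) * (1 + g)" by (simp add: power2_eq_square algebra_simps)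
      also have "\<dots> \<le> \<tau> * (1 - g) * 2" using True assms by (intro mult_left_mono) auto
      also have "\<dots> \<le> (1 - g)\<^sup>2 + \<tau>\<^sup>2"
        using zero_le_power2[of "1 - g - \<tau>"] by (simp add: power2_eq_square algebra_simps)
      finally have "\<tau> * (1 - g\<^sup>2) \<le> (1 - g)\<^sup>2 + \<tau>\<^sup>2" .
      moreover have "max 0 (1 - g\<^sup>2) = 1 - g\<^sup>2" using True g(1) by (simp add: power_le_one del: g(2))
      ultimately show ?thesis using 2 by linarith
    next
      case False
      then have "1 \<le> g\<^sup>2" by (simp add: one_le_power)
      then show ?thesis using 2 by (smt (verit) max_def mult_eq_0_iff zero_le_power2)
    qed
  qed
  have "\<tau> * max 0 (b - a) = b * (\<tau> * max 0 (1 - g\<^sup>2))"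
    using assms a by (auto simp: max_def algebra_simps)
  also have "\<dots> \<le> b * (g\<^sup>2 * ln (g\<^sup>2) - g\<^sup>2 + 1 + \<tau>\<^sup>2)"
    using main assms by (intro mult_left_mono) auto
  also have "\<dots> = a * ln (a / b) - a + b + \<tau>\<^sup>2 * b"
    using a g assms by (simp add: algebra_simps)
  finally show ?thesis .
qed

section \<open>Derandomised sampling of cells\<close>

lemma exists_le_average:
  fixes \<mu> g :: "'c \<Rightarrow> real"
  assumes "finite C" "\<And>c. c \<in> C \<Longrightarrow> 0 \<le> \<mu> c" "(\<Sum>c\<in>C. \<mu> c) = 1"
    and "(\<Sum>c\<in>C. \<mu> c * g c) \<le> b"
  shows "\<exists>c\<in>C. g c \<le> b"
proof (rule ccontr)
  assume "\<not> ?thesis"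
  then have gt: "\<And>c. c \<in> C \<Longrightarrow> b < g c" by (simp add: not_le)
  have "\<exists>c\<in>C. \<mu> c \<noteq> 0" using assms(3) by (metis sum.neutral zero_neq_one)
  then obtain c where c: "c \<in> C" "\<mu> c > 0" using assms(2) by (metis order_less_le)
  have "(\<Sum>c\<in>C. \<mu> c * b) < (\<Sum>c\<in>C. \<mu> c * g c)"
    by (rule sum_strict_mono_ex1[OF assms(1)])
      (use c gt assms(2) in \<open>auto intro!: mult_left_mono mult_strict_left_mono bexI[of _ c] simp: less_imp_le\<close>)
  then show False using assms(3,4) by (simp flip: sum_distrib_right)
qed

definition best :: "('c \<Rightarrow> real) \<Rightarrow> 'c list \<Rightarrow> real" where
  "best z G = foldr (\<lambda>c. min (z c)) G 1"

lemma best_Nil [simp]: "best z [] = 1" and best_Cons [simp]: "best z (c # G) = min (z c) (best z G)"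
  by (simp_all add: best_def)

lemma best_attained: "best z G = 1 \<or> (\<exists>c\<in>set G. best z G = z c)"
  by (induction G) (auto simp: min_def)

text \<open>Derandomised rejection sampling: \<open>\<alpha> u\<close> is the acceptance probability, which must sum up to the same \<open>p\<close>
  for all \<open>u\<close> in order that the total deficit shrinks by \<open>1 - p\<close> with every cell that is added.\<close>

lemma greedy_hitting_list:
  fixes \<mu> :: "'c \<Rightarrow> real" and \<alpha> z :: "'u \<Rightarrow> 'c \<Rightarrow> real"
  assumes C: "finite C" and \<mu>: "\<And>c. c \<in> C \<Longrightarrow> 0 \<le> \<mu> c" "(\<Sum>c\<in>C. \<mu> c) = 1"
    and \<alpha>: "\<And>u c. u \<in> U \<Longrightarrow> c \<in> C \<Longrightarrow> 0 \<le> \<alpha> u c \<and> \<alpha> u c \<le> 1"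
    and p: "\<And>u. u \<in> U \<Longrightarrow> (\<Sum>c\<in>C. \<mu> c * \<alpha> u c) = p" "0 < p" "p \<le> 1"
    and z: "\<And>u c. u \<in> U \<Longrightarrow> c \<in> C \<Longrightarrow> 0 \<le> z u c"
  shows "\<exists>G. length G = N \<and> set G \<subseteq> C \<and>
    (\<Sum>u\<in>U. best (z u) G) \<le> (\<Sum>u\<in>U. (\<Sum>c\<in>C. \<mu> c * \<alpha> u c * z u c) / p) + (1 - p) ^ N * card U"
proof (induction N)
  case 0
  have "0 \<le> (\<Sum>u\<in>U. (\<Sum>c\<in>C. \<mu> c * \<alpha> u c * z u c) / p)"
    using \<mu> \<alpha> z p(2) by (intro sum_nonneg divide_nonneg_pos mult_nonneg_nonneg) auto
  then show ?case by simp
next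
  case (Suc N)
  define Z where "Z = (\<Sum>u\<in>U. \<Sum>c\<in>C. \<mu> c * \<alpha> u c * z u c)"
  obtain G where G: "length G = N" "set G \<subseteq> C"
    "(\<Sum>u\<in>U. best (z u) G) \<le> Z / p + (1 - p) ^ N * card U"
    using Suc by (auto simp: Z_def sum_divide_distrib)
  have "(\<Sum>c\<in>C. \<mu> c * (\<Sum>u\<in>U. best (z u) (c # G)))
      \<le> (\<Sum>c\<in>C. \<mu> c * (\<Sum>u\<in>U. \<alpha> u c * z u c + (1 - \<alpha> u c) * best (z u) G))"
  proof (intro sum_mono mult_left_mono)
    fix c u assume "c \<in> C" "u \<in> U"
    then have *: "0 \<le> \<alpha> u c" "\<alpha> u c \<le> 1" using \<alpha> by auto
    \<comment> \<open>The minimum is bounded by the new value with weight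
      \<open>\<alpha> u c\<close> and by the old one with the remaining weight: acceptance is a
      weight in the analysis, not a random choice.\<close>
    have "\<alpha> u c * best (z u) (c # G) + (1 - \<alpha> u c) * best (z u) (c # G)
        \<le> \<alpha> u c * z u c + (1 - \<alpha> u c) * best (z u) G"
      using * by (intro add_mono mult_left_mono) auto
    then show "best (z u) (c # G) \<le> \<alpha> u c * z u c + (1 - \<alpha> u c) * best (z u) G"
      by (simp add: algebra_simps)
  qed (use \<mu> in auto)
  also have "\<dots> = (\<Sum>u\<in>U. \<Sum>c\<in>C. \<mu> c * (\<alpha> u c * z u c + (1 - \<alpha> u c) * best (z u) G))"
    by (subst sum.swap) (simp add: sum_distrib_left)
  also have "\<dots> = (\<Sum>u\<in>U. (\<Sum>c\<in>C. \<mu> c * \<alpha> u c * z u c) + (1 - p) * best (z u) G)"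
  proof (intro sum.cong refl)
    fix u assume u: "u \<in> U"
    have "(\<Sum>c\<in>C. \<mu> c * (\<alpha> u c * z u c + (1 - \<alpha> u c) * best (z u) G))
      = (\<Sum>c\<in>C. \<mu> c * \<alpha> u c * z u c) + ((\<Sum>c\<in>C. \<mu> c) - (\<Sum>c\<in>C. \<mu> c * \<alpha> u c)) * best (z u) G"
      by (simp add: sum_distrib_right sum_distrib_left sum.distrib sum_subtractf algebra_simps)
    then show "(\<Sum>c\<in>C. \<mu> c * (\<alpha> u c * z u c + (1 - \<alpha> u c) * best (z u) G)) =
      (\<Sum>c\<in>C. \<mu> c * \<alpha> u c * z u c) + (1 - p) * best (z u) G" using u p \<mu> by simp
  qed
  also have "\<dots> = Z + (1 - p) * (\<Sum>u\<in>U. best (z u) G)"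
    by (simp add: Z_def sum.distrib sum_distrib_left)
  also have "\<dots> \<le> Z + (1 - p) * (Z / p + (1 - p) ^ N * card U)"
    using G p by (intro add_left_mono mult_left_mono) auto
  also have "\<dots> = Z / p + (1 - p) ^ Suc N * card U" using p by (simp add: field_simps)
  finally obtain c where c: "c \<in> C"
    "(\<Sum>u\<in>U. best (z u) (c # G)) \<le> Z / p + (1 - p) ^ Suc N * card U"
    using exists_le_average[OF C \<mu>, of "\<lambda>c. \<Sum>u\<in>U. best (z u) (c # G)"] by blast
  then show ?case using G by (intro exI[of _ "c # G"]) (auto simp: Z_def sum_divide_distrib)
qed

text \<open>The value 1 of \<open>best\<close> on the empty list charges a full error to every \<open>u\<close> for which no sample is
  useful; so are those \<open>u\<close> whose distribution \<open>\<nu> u\<close> is mostly not dominated by \<open>R * \<mu>\<close>.\<close>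

lemma sampling_list:
  fixes \<mu> :: "'c \<Rightarrow> real" and \<nu> z :: "'u \<Rightarrow> 'c \<Rightarrow> real"
  assumes C: "finite C" and U: "finite U" "U \<noteq> {}"
    and \<nu>: "\<And>u c. u \<in> U \<Longrightarrow> c \<in> C \<Longrightarrow> 0 \<le> \<nu> u c" "\<And>u. u \<in> U \<Longrightarrow> (\<Sum>c\<in>C. \<nu> u c) = 1"
    and \<mu>: "\<And>c. c \<in> C \<Longrightarrow> \<mu> c = (\<Sum>u\<in>U. \<nu> u c) / card U"
    and z: "\<And>u c. u \<in> U \<Longrightarrow> c \<in> C \<Longrightarrow> 0 \<le> z u c \<and> z u c \<le> 1" and R: "R \<ge> 1"
  shows "\<exists>G. length G = N \<and> set G \<subseteq> C \<and>
    (\<Sum>u\<in>U. best (z u) G) \<le>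
      (\<Sum>u\<in>U. (\<Sum>c\<in>C. \<nu> u c * z u c) + 2 * (\<Sum>c\<in>C. max 0 (\<nu> u c - R * \<mu> c)))
      + (1 - 1 / (2 * R)) ^ N * card U"
proof -
  have cU: "card U > 0" using U by (simp add: card_gt_0_iff)
  have \<mu>0: "0 \<le> \<mu> c" if "c \<in> C" for c
    using that \<mu> \<nu> by (auto intro!: sum_nonneg divide_nonneg_nonneg)
  have "(\<Sum>c\<in>C. \<mu> c) = (\<Sum>c\<in>C. \<Sum>u\<in>U. \<nu> u c) / card U"
    using \<mu> by (simp add: sum_divide_distrib)
  also have "\<dots> = 1" using \<nu> cU by (subst sum.swap) simp
  finally have \<mu>1: "(\<Sum>c\<in>C. \<mu> c) = 1" .
  have zero: "\<nu> u c = 0" if "\<mu> c = 0" "c \<in> C" "u \<in> U" for u c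
  proof -
    have "(\<Sum>u\<in>U. \<nu> u c) = 0" using that \<mu>[of c] cU by simp
    then show ?thesis using that \<nu> U by (subst (asm) sum_nonneg_eq_0_iff) auto
  qed
  define m where "m u c = min (\<nu> u c) (R * \<mu> c)" for u c
  define M where "M u = (\<Sum>c\<in>C. m u c)" for u
  have m0: "0 \<le> m u c" if "u \<in> U" "c \<in> C" for u c
    using that \<nu> \<mu>0 R by (auto simp: m_def)
  have M: "M u = 1 - (\<Sum>c\<in>C. max 0 (\<nu> u c - R * \<mu> c))" if "u \<in> U" for u
  proof -
    have "M u = (\<Sum>c\<in>C. \<nu> u c - max 0 (\<nu> u c - R * \<mu> c))"
      unfolding M_def m_def by (intro sum.cong) auto
    then show ?thesis using that \<nu> by (simp add: sum_subtractf)
  qed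
  \<comment> \<open>If \<open>M u \<ge> 1 / 2\<close>, accepted samples are distributed as
    \<open>m u\<close> divided by its mass \<open>M u\<close>, and the factor 2 keeps the acceptance
    at most 1. Otherwise acceptance is blind and merely keeps the total \<open>1 / (2 * R)\<close>
    the same for all \<open>u\<close>.\<close>
  define \<alpha> where "\<alpha> u c = (if M u \<ge> 1 / 2 then m u c / (2 * R * M u * \<mu> c) else 1 / (2 * R))" for u c
  have \<mu>\<alpha>: "\<mu> c * \<alpha> u c = (if M u \<ge> 1 / 2 then m u c / (2 * R * M u) else \<mu> c / (2 * R))"
    if "u \<in> U" "c \<in> C" for u c
    using that zero[of c u] by (cases "\<mu> c = 0") (auto simp: \<alpha>_def m_def)
  have \<alpha>: "0 \<le> \<alpha> u c \<and> \<alpha> u c \<le> 1" if "u \<in> U" "c \<in> C" for u c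
  proof (cases "M u \<ge> 1 / 2 \<and> \<mu> c \<noteq> 0")
    case True
    then have "\<mu> c > 0" using \<mu>0[of c] that by simp
    have "m u c \<le> 1 * (R * \<mu> c)" by (simp add: m_def)
    also have "1 * (R * \<mu> c) \<le> (2 * M u) * (R * \<mu> c)"
      using True \<open>\<mu> c > 0\<close> R by (intro mult_right_mono) auto
    finally show ?thesis using True \<open>\<mu> c > 0\<close> R m0[OF that] by (simp add: \<alpha>_def field_simps)
  next
    case False
    then show ?thesis using R by (auto simp: \<alpha>_def)
  qed
  have p: "(\<Sum>c\<in>C. \<mu> c * \<alpha> u c) = 1 / (2 * R)" if "u \<in> U" for u
  proof -
    have "(\<Sum>c\<in>C. \<mu> c * \<alpha> u c) = (\<Sum>c\<in>C. if M u \<ge> 1 / 2 then m u c / (2 * R * M u) else \<mu> c / (2 * R))"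
      using \<mu>\<alpha> that by simp
    also have "\<dots> = 1 / (2 * R)"
      using \<mu>1 by (cases "M u \<ge> 1 / 2") (auto simp flip: sum_divide_distrib M_def)
    finally show ?thesis .
  qed
  obtain G where G: "length G = N" "set G \<subseteq> C"
    "(\<Sum>u\<in>U. best (z u) G) \<le> (\<Sum>u\<in>U. (\<Sum>c\<in>C. \<mu> c * \<alpha> u c * z u c) / (1 / (2 * R)))
       + (1 - 1 / (2 * R)) ^ N * card U"
    using greedy_hitting_list[of C \<mu> U \<alpha> "1 / (2 * R)" z N] C \<mu>0 \<mu>1 \<alpha> p R z by auto
  have "(\<Sum>c\<in>C. \<mu> c * \<alpha> u c * z u c) / (1 / (2 * R))
      \<le> (\<Sum>c\<in>C. \<nu> u c * z u c) + 2 * (\<Sum>c\<in>C. max 0 (\<nu> u c - R * \<mu> c))" if u: "u \<in> U" for u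
  proof (cases "M u \<ge> 1 / 2")
    case True
    define W where "W = (\<Sum>c\<in>C. m u c * z u c)"
    have "W \<le> M u" unfolding W_def M_def
      using m0 z u by (intro sum_mono mult_left_le) auto
    have "M u \<le> 1" using M[OF u] by (simp add: sum_nonneg)
    have "(\<Sum>c\<in>C. \<mu> c * \<alpha> u c * z u c) = W / (2 * R * M u)"
      using True u by (simp add: \<mu>\<alpha> W_def sum_divide_distrib)
    then have "(\<Sum>c\<in>C. \<mu> c * \<alpha> u c * z u c) / (1 / (2 * R)) = W / M u"
      using True R by simp
    \<comment> \<open>Renormalising by \<open>M u\<close> costs at most the missing mass, because
      \<open>W / M u \<le> 1\<close>.\<close>
    also have "\<dots> = W + (W / M u) * (1 - M u)" using True by (simp add: field_simps)
    also have "\<dots> \<le> W + 1 * (1 - M u)"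
      using True \<open>W \<le> M u\<close> \<open>M u \<le> 1\<close> by (intro add_left_mono mult_right_mono) auto
    also have "W \<le> (\<Sum>c\<in>C. \<nu> u c * z u c)" unfolding W_def m_def
      using z u by (intro sum_mono mult_right_mono) auto
    finally show ?thesis using M[OF u] \<open>M u \<le> 1\<close> by simp
  next
    case False
    have "(\<Sum>c\<in>C. \<mu> c * \<alpha> u c * z u c) = (\<Sum>c\<in>C. \<mu> c * z u c) / (2 * R)"
      using False u by (simp add: \<mu>\<alpha> sum_divide_distrib)
    then have "(\<Sum>c\<in>C. \<mu> c * \<alpha> u c * z u c) / (1 / (2 * R)) = (\<Sum>c\<in>C. \<mu> c * z u c)"
      using R by simp
    also have "\<dots> \<le> (\<Sum>c\<in>C. \<mu> c)" using \<mu>0 z u by (intro sum_mono mult_left_le) auto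
    \<comment> \<open>More than half of the mass is missing here, so twice the missing mass pays for
      a full error. This is the origin of the factor 2 in the conclusion.\<close>
    also have "\<dots> \<le> 2 * (1 - M u)" using False \<mu>1 by simp
    also have "\<dots> \<le> (\<Sum>c\<in>C. \<nu> u c * z u c) + 2 * (\<Sum>c\<in>C. max 0 (\<nu> u c - R * \<mu> c))"
      using M[OF u] \<nu> z u by (simp add: sum_nonneg)
    finally show ?thesis .
  qed
  then have "(\<Sum>u\<in>U. (\<Sum>c\<in>C. \<mu> c * \<alpha> u c * z u c) / (1 / (2 * R)))
    \<le> (\<Sum>u\<in>U. (\<Sum>c\<in>C. \<nu> u c * z u c) + 2 * (\<Sum>c\<in>C. max 0 (\<nu> u c - R * \<mu> c)))"
    by (rule sum_mono)
  with G show ?thesis by (intro exI[of _ G]) auto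
qed

section \<open>Strings of digits and the entropy along a random string\<close>

definition tuples :: "nat \<Rightarrow> 'a set \<Rightarrow> 'a list set" where
  "tuples k X = {xs. set xs \<subseteq> X \<and> length xs = k}"

lemma finite_tuples [simp]: "finite X \<Longrightarrow> finite (tuples k X)"
  by (simp add: tuples_def finite_lists_length_eq)

lemma card_tuples: "finite X \<Longrightarrow> card (tuples k X) = card X ^ k"
  by (simp add: tuples_def card_lists_length_eq)

lemma tuples_0 [simp]: "tuples 0 X = {[]}"
  by (auto simp: tuples_def)

lemma take_tuples: "xs \<in> tuples k X \<Longrightarrow> i \<le> k \<Longrightarrow> take i xs \<in> tuples i X"
  by (auto simp: tuples_def dest: in_set_takeD)

lemma nth_tuples: "xs \<in> tuples k X \<Longrightarrow> i < k \<Longrightarrow> xs ! i \<in> X"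
  by (auto simp: tuples_def)

lemma append_tuples: "v \<in> tuples i X \<Longrightarrow> s \<in> tuples j X \<Longrightarrow> v @ s \<in> tuples (i + j) X"
  by (auto simp: tuples_def)

lemma sum_tuples_append:
  "(\<Sum>x\<in>tuples (a + b) X. F x) = (\<Sum>v\<in>tuples a X. \<Sum>s\<in>tuples b X. F (v @ s))"
proof -
  have "(\<Sum>x\<in>tuples (a + b) X. F x) = (\<Sum>(v, s)\<in>tuples a X \<times> tuples b X. F (v @ s))"
    by (rule sum.reindex_bij_witness[of _ "\<lambda>(v, s). v @ s" "\<lambda>x. (take a x, drop a x)"])
      (auto simp: tuples_def dest: in_set_takeD in_set_dropD)
  then show ?thesis by (simp add: sum.cartesian_product)
qed

lemma sum_tuples_1: "(\<Sum>x\<in>tuples (Suc 0) X. F x) = (\<Sum>u\<in>X. F [u])"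
  by (rule sum.reindex_bij_witness[of _ "\<lambda>u. [u]" hd]) (auto simp: tuples_def length_Suc_conv)

lemma sum_tuples_split:
  assumes "i < k"
  shows "(\<Sum>x\<in>tuples k X. F x)
    = (\<Sum>v\<in>tuples i X. \<Sum>u\<in>X. \<Sum>s\<in>tuples (k - i - 1) X. F (v @ u # s))"
proof -
  have "(\<Sum>x\<in>tuples (i + (Suc 0 + (k - i - 1))) X. F x)
    = (\<Sum>v\<in>tuples i X. \<Sum>u\<in>X. \<Sum>s\<in>tuples (k - i - 1) X. F (v @ u # s))"
    unfolding sum_tuples_append sum_tuples_1 by simp
  then show ?thesis using assms by simp
qed

lemma sum_tuples_take:
  fixes F :: "'a list \<Rightarrow> real"
  assumes "finite X" "i \<le> k"
  shows "(\<Sum>x\<in>tuples k X. F (take i x)) = card X ^ (k - i) * (\<Sum>v\<in>tuples i X. F v)"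
proof -
  have "(\<Sum>x\<in>tuples (i + (k - i)) X. F (take i x)) = (\<Sum>v\<in>tuples i X. \<Sum>s\<in>tuples (k - i) X. F v)"
    unfolding sum_tuples_append by (intro sum.cong refl) (auto simp: tuples_def)
  then show ?thesis using assms by (simp add: card_tuples sum_distrib_left)
qed

text \<open>Expressing all prefix lengths as sums over the same set \<open>tuples k X\<close> is
  what later lets the entropies of consecutive positions telescope.\<close>

lemma sum_tuples_take_Suc:
  fixes F :: "'a list \<Rightarrow> real"
  assumes "finite X" "X \<noteq> {}" "i < k"
  shows "(\<Sum>x\<in>tuples k X. F (take (Suc i) x)) = (\<Sum>x\<in>tuples k X. (\<Sum>u\<in>X. F (take i x @ [u])) / card X)"
proof -
  have c: "card X > 0" using assms by (simp add: card_gt_0_iff)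
  have "(\<Sum>x\<in>tuples k X. F (take (Suc i) x))
      = card X ^ (k - Suc i) * (\<Sum>v\<in>tuples (i + Suc 0) X. F v)"
    using assms by (subst sum_tuples_take) auto
  also have "\<dots> = card X ^ (k - Suc i) * (\<Sum>v\<in>tuples i X. \<Sum>u\<in>X. F (v @ [u]))"
    by (subst sum_tuples_append) (simp add: sum_tuples_1)
  also have "\<dots> = card X ^ (k - i) * (\<Sum>v\<in>tuples i X. (\<Sum>u\<in>X. F (v @ [u])) / card X)"
    using assms c by (simp add: Suc_diff_Suc[symmetric] flip: sum_divide_distrib)
  also have "\<dots> = (\<Sum>x\<in>tuples k X. (\<Sum>u\<in>X. F (take i x @ [u])) / card X)"
    using assms by (subst sum_tuples_take[symmetric]) auto
  finally show ?thesis .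
qed

lemma entropy_le_ln_card:
  fixes \<mu> :: "'c \<Rightarrow> real"
  assumes "finite C" "\<And>c. c \<in> C \<Longrightarrow> 0 \<le> \<mu> c" "(\<Sum>c\<in>C. \<mu> c) = 1"
  shows "- (\<Sum>c\<in>C. \<mu> c * ln (\<mu> c)) \<le> ln (card C)"
proof -
  have C: "card C > 0" using assms by (auto simp: card_gt_0_iff)
  have "- (\<mu> c * ln (\<mu> c)) - \<mu> c * ln (card C) \<le> 1 / card C - \<mu> c" if "c \<in> C" for c
  proof (cases "\<mu> c = 0")
    case False
    then have pos: "\<mu> c > 0" using assms that by (auto simp: order_less_le)
    have "ln (1 / (card C * \<mu> c)) \<le> 1 / (card C * \<mu> c) - 1" using pos C by (intro ln_le_minus_one) simp
    then have "\<mu> c * ln (1 / (card C * \<mu> c)) \<le> \<mu> c * (1 / (card C * \<mu> c) - 1)"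
      using pos by (intro mult_left_mono) auto
    also have "\<dots> = 1 / card C - \<mu> c" using pos by (simp add: field_simps)
    finally show ?thesis using pos C by (simp add: ln_div ln_mult algebra_simps)
  qed simp
  then have "(\<Sum>c\<in>C. - (\<mu> c * ln (\<mu> c)) - \<mu> c * ln (card C)) \<le> (\<Sum>c\<in>C. 1 / card C - \<mu> c)"
    by (rule sum_mono)
  moreover have "(\<Sum>c\<in>C. 1 / card C) = 1" using C by simp
  ultimately show ?thesis using assms(3)
    by (simp add: sum_subtractf sum_negf flip: sum_distrib_right)
qed

text \<open>The entropy of the label of a random leaf decreases by the average divergence between
  child and parent, so these divergences telescope.\<close>

lemma sum_prefix_excess_le:
  fixes \<mu> :: "'q list \<Rightarrow> 'c \<Rightarrow> real"
  assumes C: "finite C" and X: "finite X" "X \<noteq> {}"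
    and nonneg: "\<And>v c. c \<in> C \<Longrightarrow> 0 \<le> \<mu> v c"
    and total: "\<And>i v. i \<le> k \<Longrightarrow> v \<in> tuples i X \<Longrightarrow> (\<Sum>c\<in>C. \<mu> v c) = 1"
    and avg: "\<And>i v c. i < k \<Longrightarrow> v \<in> tuples i X \<Longrightarrow> c \<in> C \<Longrightarrow> \<mu> v c = (\<Sum>u\<in>X. \<mu> (v @ [u]) c) / card X"
    and R: "R > 0" "1 \<le> ln R"
  shows "(ln R - 1) * (\<Sum>i<k. \<Sum>x\<in>tuples k X.
      (\<Sum>u\<in>X. \<Sum>c\<in>C. max 0 (\<mu> (take i x @ [u]) c - R * \<mu> (take i x) c)) / card X)
    \<le> card X ^ k * ln (card C)"
proof -
  have cX: "card X > 0" using X by (simp add: card_gt_0_iff)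
  define H where "H v = - (\<Sum>c\<in>C. \<mu> v c * ln (\<mu> v c))" for v
  have step: "(ln R - 1) * ((\<Sum>u\<in>X. \<Sum>c\<in>C. max 0 (\<mu> (v @ [u]) c - R * \<mu> v c)) / card X)
      \<le> H v - (\<Sum>u\<in>X. H (v @ [u])) / card X"
    if i: "i < k" and v: "v \<in> tuples i X" for i v
  proof -
    have child: "v @ [u] \<in> tuples (Suc i) X" if "u \<in> X" for u
      using that v by (auto simp: tuples_def)
    have zero: "\<mu> (v @ [u]) c = 0" if "\<mu> v c = 0" "c \<in> C" "u \<in> X" for u c
    proof -
      have "(\<Sum>u\<in>X. \<mu> (v @ [u]) c) = 0" using that avg[OF i v, of c] cX by simp
      then show ?thesis using that nonneg X by (subst (asm) sum_nonneg_eq_0_iff) auto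
    qed
    have sumavg: "(\<Sum>u\<in>X. \<mu> (v @ [u]) c) = card X * \<mu> v c" if "c \<in> C" for c
      using avg[OF i v that] cX by simp
    have "(ln R - 1) * (\<Sum>u\<in>X. \<Sum>c\<in>C. max 0 (\<mu> (v @ [u]) c - R * \<mu> v c))
        = (\<Sum>u\<in>X. \<Sum>c\<in>C. (ln R - 1) * max 0 (\<mu> (v @ [u]) c - R * \<mu> v c))"
      by (simp add: sum_distrib_left)
    also have "\<dots> \<le> (\<Sum>u\<in>X. \<Sum>c\<in>C. \<mu> (v @ [u]) c * ln (\<mu> (v @ [u]) c / \<mu> v c) - \<mu> (v @ [u]) c + \<mu> v c)"
      using nonneg zero R by (intro sum_mono kl_above) auto
    also have "\<dots> = (\<Sum>u\<in>X. (\<Sum>c\<in>C. \<mu> (v @ [u]) c * ln (\<mu> (v @ [u]) c / \<mu> v c)) - 1 + 1)"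
      using total[of i v] total[of "Suc i"] i v child by (intro sum.cong refl) (simp add: sum.distrib sum_subtractf)
    also have "\<dots> = (\<Sum>u\<in>X. \<Sum>c\<in>C. \<mu> (v @ [u]) c * ln (\<mu> (v @ [u]) c) - \<mu> (v @ [u]) c * ln (\<mu> v c))"
    proof -
      have "\<mu> (v @ [u]) c * ln (\<mu> (v @ [u]) c / \<mu> v c)
        = \<mu> (v @ [u]) c * ln (\<mu> (v @ [u]) c) - \<mu> (v @ [u]) c * ln (\<mu> v c)" if "u \<in> X" "c \<in> C" for u c
      proof (cases "\<mu> (v @ [u]) c = 0")
        case False
        then show ?thesis using zero[of c u] nonneg[of c v] nonneg[of c "v @ [u]"] that
          by (subst ln_div) (auto simp: order_less_le algebra_simps)
      qed simp
      then show ?thesis by simp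
    qed
    also have "\<dots> = (\<Sum>u\<in>X. - H (v @ [u])) - (\<Sum>c\<in>C. (\<Sum>u\<in>X. \<mu> (v @ [u]) c) * ln (\<mu> v c))"
    proof -
      have "(\<Sum>c\<in>C. (\<Sum>u\<in>X. \<mu> (v @ [u]) c) * ln (\<mu> v c)) = (\<Sum>u\<in>X. \<Sum>c\<in>C. \<mu> (v @ [u]) c * ln (\<mu> v c))"
        by (subst sum.swap) (simp add: sum_distrib_right)
      then show ?thesis by (simp add: H_def sum_subtractf)
    qed
    also have "\<dots> = card X * H v - (\<Sum>u\<in>X. H (v @ [u]))"
      by (simp add: H_def sumavg sum_negf sum_distrib_left mult.assoc)
    finally have "(ln R - 1) * (\<Sum>u\<in>X. \<Sum>c\<in>C. max 0 (\<mu> (v @ [u]) c - R * \<mu> v c)) / card X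
        \<le> (card X * H v - (\<Sum>u\<in>X. H (v @ [u]))) / card X"
      by (intro divide_right_mono) auto
    then show ?thesis using cX by (simp add: diff_divide_distrib)
  qed
  define h where "h i = (\<Sum>x\<in>tuples k X. H (take i x))" for i
  have "(ln R - 1) * (\<Sum>i<k. \<Sum>x\<in>tuples k X.
      (\<Sum>u\<in>X. \<Sum>c\<in>C. max 0 (\<mu> (take i x @ [u]) c - R * \<mu> (take i x) c)) / card X)
    = (\<Sum>i<k. \<Sum>x\<in>tuples k X. (ln R - 1) *
      ((\<Sum>u\<in>X. \<Sum>c\<in>C. max 0 (\<mu> (take i x @ [u]) c - R * \<mu> (take i x) c)) / card X))"
    by (simp add: sum_distrib_left)
  also have "\<dots> \<le> (\<Sum>i<k. \<Sum>x\<in>tuples k X. H (take i x) - (\<Sum>u\<in>X. H (take i x @ [u])) / card X)"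
    by (intro sum_mono step) (auto intro: take_tuples)
  also have "\<dots> = (\<Sum>i<k. h i - h (Suc i))"
    by (intro sum.cong refl) (use sum_tuples_take_Suc[OF X, where F = H] in \<open>simp add: h_def sum_subtractf\<close>)
  also have "\<dots> = h 0 - h k" by (rule sum_lessThan_telescope')
  also have "h 0 = card X ^ k * H []" using X by (simp add: h_def card_tuples)
  also have "\<dots> - h k \<le> card X ^ k * ln (card C)"
  proof -
    have "H [] \<le> ln (card C)" unfolding H_def using C nonneg total[of 0] by (intro entropy_le_ln_card) auto
    moreover have "0 \<le> H (take k x)" if "x \<in> tuples k X" for x
    proof -
      have "\<mu> (take k x) c * ln (\<mu> (take k x) c) \<le> 0" if c: "c \<in> C" for c
      proof -
        have "\<mu> (take k x) c \<le> (\<Sum>c\<in>C. \<mu> (take k x) c)" using C nonneg c by (intro member_le_sum) auto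
        then have le1: "\<mu> (take k x) c \<le> 1" using total[of k "take k x"] \<open>x \<in> tuples k X\<close> take_tuples by fastforce
        then show ?thesis using nonneg[OF c, of "take k x"]
          by (cases "\<mu> (take k x) c = 0") (auto intro!: mult_nonneg_nonpos)
      qed
      then show ?thesis by (simp add: H_def sum_nonpos)
    qed
    then have "0 \<le> h k" by (simp add: h_def sum_nonneg)
    ultimately show ?thesis by (smt (verit, best) mult_left_mono of_nat_0_le_iff zero_le_power)
  qed
  finally show ?thesis .
qed

section \<open>Coordinates of a dense subset of a product\<close>

lemma sum_PiE_prod:
  fixes \<nu> :: "nat \<Rightarrow> 'i \<Rightarrow> real"
  assumes "finite I" "\<And>j. j < K \<Longrightarrow> (\<Sum>y\<in>I. \<nu> j y) = 1"
  shows "(\<Sum>Y\<in>PiE {..<K} (\<lambda>_. I). \<Prod>j<K. \<nu> j (Y j)) = 1"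
  using assms prod_sum_PiE[of "{..<K}" "\<lambda>_. I" \<nu>] by simp

lemma sum_PiE_coordinate:
  fixes g :: "'i \<Rightarrow> real"
  assumes "finite I" "j < K"
  shows "(\<Sum>Y\<in>PiE {..<K} (\<lambda>_. I). g (Y j)) = card I ^ (K - 1) * (\<Sum>y\<in>I. g y)"
proof -
  have "(\<Sum>Y\<in>PiE {..<K} (\<lambda>_. I). g (Y j)) =
      (\<Sum>Y\<in>PiE {..<K} (\<lambda>_. I). \<Prod>i<K. if i = j then g (Y i) else 1)"
    using assms by (intro sum.cong refl) (simp add: prod.delta)
  also have "\<dots> = (\<Prod>i<K. \<Sum>y\<in>I. if i = j then g y else 1)"
    using assms prod_sum_PiE[of "{..<K}" "\<lambda>_. I" "\<lambda>i y. if i = j then g y else 1"] by simp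
  also have "\<dots> = (\<Prod>i\<in>{..<K} - {j}. real (card I)) * (\<Sum>y\<in>I. g y)"
    using assms by (subst prod.remove[of _ j]) (auto intro!: prod.cong)
  finally show ?thesis using assms by simp
qed

lemma sum_by_value:
  fixes g :: "'i \<Rightarrow> real"
  assumes "finite A" "finite I" "\<And>Y. Y \<in> A \<Longrightarrow> h Y \<in> I"
  shows "(\<Sum>y\<in>I. card {Y \<in> A. h Y = y} * g y) = (\<Sum>Y\<in>A. g (h Y))"
proof -
  have "(\<Sum>Y\<in>A. g (h Y)) = (\<Sum>y\<in>I. \<Sum>Y\<in>{Y \<in> A. h Y = y}. g (h Y))"
    using assms by (subst sum.group) auto
  also have "\<dots> = (\<Sum>y\<in>I. \<Sum>Y\<in>{Y \<in> A. h Y = y}. g y)" by (intro sum.cong) auto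
  finally show ?thesis by simp
qed

text \<open>Subadditivity of entropy: a set \<open>A\<close> of relative density \<open>1 / B\<close> has coordinates with total
  divergence at most \<open>ln B\<close> from uniform. The parameter \<open>\<tau>\<close> linearises Pinsker's inequality.\<close>

lemma sum_marginal_deficit_le:
  fixes I :: "'i set"
  assumes I: "finite I" "I \<noteq> {}" and A: "A \<subseteq> PiE {..<K} (\<lambda>_. I)" "A \<noteq> {}" and \<tau>: "\<tau> > 0"
  shows "(\<Sum>j<K. \<Sum>y\<in>I. max 0 (1 / card I - card {Y \<in> A. Y j = y} / card A))
    \<le> ln (card I ^ K / card A) / \<tau> + K * \<tau>"
proof -
  define \<nu> where "\<nu> j y = card {Y \<in> A. Y j = y} / card A" for j y
  have fA: "finite A" using A I by (auto intro: finite_subset finite_PiE)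
  have cA: "card A > 0" using A fA by (simp add: card_gt_0_iff)
  have cI: "card I > 0" using I by (simp add: card_gt_0_iff)
  have mem: "Y j \<in> I" if "Y \<in> A" "j < K" for Y j using A that by auto
  have sum\<nu>: "(\<Sum>y\<in>I. \<nu> j y * g y) = (\<Sum>Y\<in>A. g (Y j)) / card A" if "j < K" for j and g :: "'i \<Rightarrow> real"
  proof -
    have "(\<Sum>y\<in>I. \<nu> j y * g y) = (\<Sum>y\<in>I. card {Y \<in> A. Y j = y} * g y) / card A"
      by (simp add: \<nu>_def sum_divide_distrib)
    then show ?thesis using sum_by_value[OF fA I(1), of "\<lambda>Y. Y j" g] mem that by simp
  qed
  have \<nu>1: "(\<Sum>y\<in>I. \<nu> j y) = 1" if "j < K" for j
    using sum\<nu>[OF that, of "\<lambda>_. 1"] cA by simp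
  have pos: "\<nu> j (Y j) > 0" if "Y \<in> A" "j < K" for Y j
    unfolding \<nu>_def using that fA cA by (intro divide_pos_pos) (auto simp: card_gt_0_iff)
  \<comment> \<open>Gibbs' inequality, comparing the product of the marginals with the uniform
    distribution on \<open>A\<close>: since the product has mass at most 1 on \<open>A\<close>, its
    logarithms sum up to at most \<open>- (card A * ln (card A))\<close>.\<close>
  have "ln (card A) + (\<Sum>j<K. ln (\<nu> j (Y j))) \<le> card A * (\<Prod>j<K. \<nu> j (Y j)) - 1" if "Y \<in> A" for Y
  proof -
    have "0 < (\<Prod>j<K. \<nu> j (Y j))" using pos that by (intro prod_pos) auto
    then have "ln (card A * (\<Prod>j<K. \<nu> j (Y j))) = ln (card A) + ln (\<Prod>j<K. \<nu> j (Y j))"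
      using cA by (intro ln_mult_pos) auto
    moreover have "ln (\<Prod>j<K. \<nu> j (Y j)) = (\<Sum>j<K. ln (\<nu> j (Y j)))"
      using pos[OF that] by (intro ln_prod) (auto simp: order_less_le)
    ultimately show ?thesis using ln_le_minus_one[of "card A * (\<Prod>j<K. \<nu> j (Y j))"] cA
      \<open>0 < (\<Prod>j<K. \<nu> j (Y j))\<close> by simp
  qed
  then have "(\<Sum>Y\<in>A. ln (card A) + (\<Sum>j<K. ln (\<nu> j (Y j)))) \<le> (\<Sum>Y\<in>A. card A * (\<Prod>j<K. \<nu> j (Y j)) - 1)"
    by (rule sum_mono)
  then have "card A * ln (card A) + (\<Sum>Y\<in>A. \<Sum>j<K. ln (\<nu> j (Y j)))
      \<le> card A * (\<Sum>Y\<in>A. \<Prod>j<K. \<nu> j (Y j)) - card A"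
    by (simp add: sum_subtractf sum_distrib_left sum.distrib)
  moreover have "(\<Sum>Y\<in>A. \<Prod>j<K. \<nu> j (Y j)) \<le> (\<Sum>Y\<in>PiE {..<K} (\<lambda>_. I). \<Prod>j<K. \<nu> j (Y j))"
    using A I by (intro sum_mono2) (auto intro!: finite_PiE prod_nonneg simp: \<nu>_def)
  then have "(\<Sum>Y\<in>A. \<Prod>j<K. \<nu> j (Y j)) \<le> 1"
    using sum_PiE_prod[OF I(1), of K \<nu>] \<nu>1 by simp
  then have "card A * (\<Sum>Y\<in>A. \<Prod>j<K. \<nu> j (Y j)) \<le> real (card A) * 1"
    by (intro mult_left_mono) auto
  ultimately have gibbs: "(\<Sum>Y\<in>A. \<Sum>j<K. ln (\<nu> j (Y j))) \<le> - (card A * ln (card A))"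
    by linarith
  have "\<tau> * (\<Sum>j<K. \<Sum>y\<in>I. max 0 (1 / card I - \<nu> j y))
      = (\<Sum>j<K. \<Sum>y\<in>I. \<tau> * max 0 (1 / card I - \<nu> j y))" by (simp add: sum_distrib_left)
  also have "\<dots> \<le> (\<Sum>j<K. \<Sum>y\<in>I. \<nu> j y * ln (\<nu> j y / (1 / card I)) - \<nu> j y + 1 / card I + \<tau>\<^sup>2 * (1 / card I))"
    using \<tau> cI by (intro sum_mono kl_below) (auto simp: \<nu>_def)
  also have "\<dots> = (\<Sum>j<K. (\<Sum>y\<in>I. \<nu> j y * ln (\<nu> j y * card I)) + \<tau>\<^sup>2)"
    using \<nu>1 cI by (intro sum.cong refl) (simp add: sum.distrib sum_subtractf)
  also have "\<dots> = (\<Sum>j<K. (\<Sum>Y\<in>A. ln (\<nu> j (Y j)) + ln (card I)) / card A + \<tau>\<^sup>2)"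
  proof (intro sum.cong refl)
    fix j assume j: "j \<in> {..<K}"
    have "(\<Sum>Y\<in>A. ln (\<nu> j (Y j) * card I)) = (\<Sum>Y\<in>A. ln (\<nu> j (Y j)) + ln (card I))"
      using pos cI j by (intro sum.cong refl ln_mult_pos) auto
    then show "(\<Sum>y\<in>I. \<nu> j y * ln (\<nu> j y * card I)) + \<tau>\<^sup>2 =
      (\<Sum>Y\<in>A. ln (\<nu> j (Y j)) + ln (card I)) / card A + \<tau>\<^sup>2"
      using sum\<nu>[of j "\<lambda>y. ln (\<nu> j y * card I)"] j by simp
  qed
  also have "\<dots> = (\<Sum>Y\<in>A. \<Sum>j<K. ln (\<nu> j (Y j))) / card A + K * ln (card I) + K * \<tau>\<^sup>2"
  proof -
    have "(\<Sum>j<K. (\<Sum>Y\<in>A. ln (\<nu> j (Y j)) + ln (card I)) / card A + \<tau>\<^sup>2)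
      = (\<Sum>j<K. (\<Sum>Y\<in>A. ln (\<nu> j (Y j))) / card A + (ln (card I) + \<tau>\<^sup>2))"
      using cA by (intro sum.cong refl) (simp add: sum.distrib add_divide_distrib)
    also have "\<dots> = (\<Sum>j<K. \<Sum>Y\<in>A. ln (\<nu> j (Y j))) / card A + K * (ln (card I) + \<tau>\<^sup>2)"
      by (simp add: sum.distrib sum_divide_distrib)
    finally show ?thesis by (subst sum.swap) (simp add: algebra_simps)
  qed
  also have "\<dots> \<le> - ln (card A) + K * ln (card I) + K * \<tau>\<^sup>2"
    using gibbs cA by (simp add: field_simps)
  also have "\<dots> = ln (card I ^ K / card A) + K * \<tau>\<^sup>2"
    using cA cI by (simp add: ln_div ln_realpow)
  finally show ?thesis using \<tau> unfolding \<nu>_def[symmetric]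
    by (simp add: field_simps power2_eq_square)
qed

section \<open>Round elimination\<close>

text \<open>Instances are uniform on \<open>I\<close>, and \<open>\<omega> y\<close> is the
  distribution of the query for the instance \<open>y\<close>. By the last condition the query alone
  is uniform on \<open>X\<close>; thus a query string is uniform for every position
  \<open>i\<close>, and its first probe can be analysed without regard to the instance.\<close>

definition query_distribution :: "'i set \<Rightarrow> 'q set \<Rightarrow> ('i \<Rightarrow> 'q \<Rightarrow> real) \<Rightarrow> bool" where
  "query_distribution I X \<omega> \<longleftrightarrow> finite I \<and> I \<noteq> {} \<and> finite X \<and> X \<noteq> {} \<and>
    (\<forall>y\<in>I. \<forall>x\<in>X. 0 \<le> \<omega> y x) \<and> (\<forall>y\<in>I. (\<Sum>x\<in>X. \<omega> y x) = 1) \<and>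
    (\<forall>x\<in>X. (\<Sum>y\<in>I. \<omega> y x) = card I / card X)"

definition error ::
  "'i set \<Rightarrow> 'q set \<Rightarrow> ('i \<Rightarrow> 'q \<Rightarrow> real) \<Rightarrow> ('i \<Rightarrow> 'q \<Rightarrow> color) \<Rightarrow>
    ('i \<Rightarrow> nat \<Rightarrow> nat) \<Rightarrow> ('i \<Rightarrow> 'q \<Rightarrow> probe_tree) \<Rightarrow> real" where
  "error I X \<omega> f M q =
    (\<Sum>y\<in>I. \<Sum>x\<in>X. \<omega> y x * of_bool (result (q y x) (M y) \<noteq> f y x)) / card I"

text \<open>Besides the cells \<open>M y\<close>, the data structure may publish \<open>\<pi> y\<close>, one of at most \<open>B\<close> values,
  which the queries read for free.\<close>

definition hard ::
  "'i set \<Rightarrow> 'q set \<Rightarrow> ('i \<Rightarrow> 'q \<Rightarrow> real) \<Rightarrow> ('i \<Rightarrow> 'q \<Rightarrow> color) \<Rightarrow> nat \<Rightarrow> nat \<Rightarrow> nat \<Rightarrow> nat \<Rightarrow> real \<Rightarrow> bool"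
where
  "hard I X \<omega> f S w t B e \<longleftrightarrow>
    (\<forall>M (\<pi> :: 'i \<Rightarrow> nat list) q.
      (\<forall>y\<in>I. \<forall>i<S. M y i < 2 ^ w) \<and>
      (\<forall>y\<in>I. \<forall>x\<in>X. set (probes (q (\<pi> y) x) (M y)) \<subseteq> {..<S} \<and> length (probes (q (\<pi> y) x) (M y)) \<le> t) \<and>
      card (\<pi> ` I) \<le> B \<longrightarrow> e \<le> error I X \<omega> f M (\<lambda>y. q (\<pi> y)))"

lemma hardD:
  fixes \<pi> :: "'i \<Rightarrow> nat list"
  assumes "hard I X \<omega> f S w t B e"
    and "\<And>y i. y \<in> I \<Longrightarrow> i < S \<Longrightarrow> M y i < 2 ^ w"
    and "\<And>y x. y \<in> I \<Longrightarrow> x \<in> X \<Longrightarrow>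
      set (probes (q (\<pi> y) x) (M y)) \<subseteq> {..<S} \<and> length (probes (q (\<pi> y) x) (M y)) \<le> t"
    and "card (\<pi> ` I) \<le> B"
  shows "e \<le> error I X \<omega> f M (\<lambda>y. q (\<pi> y))"
  using assms unfolding hard_def by blast

lemma query_distribution_blocks:
  fixes K :: nat
  assumes "query_distribution I X \<omega>" "K > 0"
  shows "query_distribution (PiE {..<K} (\<lambda>_. I)) ({..<K} \<times> X) (\<lambda>Y (j, x). \<omega> (Y j) x / K)"
proof -
  have I: "finite I" "I \<noteq> {}" "finite X" "X \<noteq> {}" and nn: "\<And>y x. y \<in> I \<Longrightarrow> x \<in> X \<Longrightarrow> 0 \<le> \<omega> y x"
    and r: "\<And>y. y \<in> I \<Longrightarrow> (\<Sum>x\<in>X. \<omega> y x) = 1" and c: "\<And>x. x \<in> X \<Longrightarrow> (\<Sum>y\<in>I. \<omega> y x) = card I / card X"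
    using assms unfolding query_distribution_def by auto
  have mem: "Y j \<in> I" if "Y \<in> PiE {..<K} (\<lambda>_. I)" "j < K" for Y j using that by auto
  have "(\<Sum>p\<in>{..<K} \<times> X. case p of (j, x) \<Rightarrow> \<omega> (Y j) x / K) = 1" if "Y \<in> PiE {..<K} (\<lambda>_. I)" for Y
  proof -
    have "(\<Sum>p\<in>{..<K} \<times> X. case p of (j, x) \<Rightarrow> \<omega> (Y j) x / K) = (\<Sum>j<K. (\<Sum>x\<in>X. \<omega> (Y j) x) / K)"
      by (simp add: sum.cartesian_product[symmetric] sum_divide_distrib)
    also have "\<dots> = (\<Sum>j<K. 1 / K)" using r mem[OF that] by (intro sum.cong) auto
    finally show ?thesis using assms by simp
  qed
  moreover have "(\<Sum>Y\<in>PiE {..<K} (\<lambda>_. I). \<omega> (Y j) x / K) = card (PiE {..<K} (\<lambda>_. I)) / card ({..<K} \<times> X)"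
    if "j < K" "x \<in> X" for j x
  proof -
    have "(\<Sum>Y\<in>PiE {..<K} (\<lambda>_. I). \<omega> (Y j) x / K) = card I ^ (K - 1) * (card I / card X) / K"
      using sum_PiE_coordinate[OF I(1) that(1), of "\<lambda>y. \<omega> y x"] c that by (simp flip: sum_divide_distrib)
    moreover have "card I ^ K = card I ^ (K - 1) * card I"
      using assms by (metis power_minus_mult)
    ultimately show ?thesis using I by (simp add: card_PiE mult.commute)
  qed
  ultimately show ?thesis unfolding query_distribution_def
    using assms I nn mem by (auto simp: finite_PiE PiE_eq_empty_iff intro!: divide_nonneg_nonneg)
qed

text \<open>The query copies the first \<open>i\<close> digits of \<open>z\<close>, draws the digit
  at position \<open>i\<close> from \<open>\<omega> y\<close> and the later ones uniformly, whence
  the divisor \<open>card X ^ (k - i - 1)\<close>. Drawing \<open>z\<close> at full length for every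
  \<open>i\<close> keeps the set of instances a product, on which position and prefix are
  uniform.\<close>

lemma query_distribution_prefix:
  assumes "query_distribution I X \<omega>" "k > 0"
  shows "query_distribution ({..<k} \<times> tuples k X \<times> I) (tuples k X)
    (\<lambda>(i, z, y) x. of_bool (take i x = take i z) * \<omega> y (x ! i) / card X ^ (k - i - 1))"
proof -
  have I: "finite I" "I \<noteq> {}" "finite X" "X \<noteq> {}" and nn: "\<And>y x. y \<in> I \<Longrightarrow> x \<in> X \<Longrightarrow> 0 \<le> \<omega> y x"
    and r: "\<And>y. y \<in> I \<Longrightarrow> (\<Sum>x\<in>X. \<omega> y x) = 1" and c: "\<And>x. x \<in> X \<Longrightarrow> (\<Sum>y\<in>I. \<omega> y x) = card I / card X"
    using assms unfolding query_distribution_def by auto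
  have cX: "card X > 0" using I by (simp add: card_gt_0_iff)
  then have "card (tuples k X) \<noteq> 0" using I by (simp add: card_tuples)
  then have ne: "tuples k X \<noteq> {}" by fastforce
  have "(\<Sum>x\<in>tuples k X. of_bool (take i x = take i z) * \<omega> y (x ! i) / card X ^ (k - i - 1)) = 1"
    if "i < k" "z \<in> tuples k X" "y \<in> I" for i z y
  proof -
    have z: "take i z \<in> tuples i X" using that by (intro take_tuples) auto
    have "(\<Sum>x\<in>tuples k X. of_bool (take i x = take i z) * \<omega> y (x ! i) / card X ^ (k - i - 1))
      = (\<Sum>v\<in>tuples i X. if v = take i z then \<Sum>u\<in>X. \<Sum>s\<in>tuples (k - i - 1) X. \<omega> y u / card X ^ (k - i - 1) else 0)"
      unfolding sum_tuples_split[OF that(1)]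
      by (intro sum.cong refl) (auto simp: tuples_def nth_append)
    also have "\<dots> = 1" using z I cX r[OF that(3)] by (simp add: card_tuples)
    finally show ?thesis .
  qed
  moreover have "(\<Sum>(i, z, y)\<in>{..<k} \<times> tuples k X \<times> I.
      of_bool (take i x = take i z) * \<omega> y (x ! i) / card X ^ (k - i - 1))
      = card ({..<k} \<times> tuples k X \<times> I) / card (tuples k X)" if x: "x \<in> tuples k X" for x
  proof -
    have "(\<Sum>(i, z, y)\<in>{..<k} \<times> tuples k X \<times> I.
      of_bool (take i x = take i z) * \<omega> y (x ! i) / card X ^ (k - i - 1))
      = (\<Sum>i<k. \<Sum>z\<in>tuples k X. \<Sum>y\<in>I. of_bool (take i x = take i z) * \<omega> y (x ! i) / card X ^ (k - i - 1))"
      by (simp add: sum.cartesian_product)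
    also have "\<dots> = (\<Sum>i<k. card I)"
      unfolding of_nat_sum
    proof (intro sum.cong refl)
      fix i assume "i \<in> {..<k}"
      then have i: "i < k" by simp
      have xi: "x ! i \<in> X" "take i x \<in> tuples i X" using x i by (auto intro: nth_tuples take_tuples[OF x])
      have "(\<Sum>z\<in>tuples k X. \<Sum>y\<in>I. of_bool (take i x = take i z) * \<omega> y (x ! i) / card X ^ (k - i - 1))
        = (\<Sum>z\<in>tuples k X. of_bool (take i x = take i z) * (card I / card X) / card X ^ (k - i - 1))"
        using c[OF xi(1)] by (simp flip: sum_divide_distrib sum_distrib_left)
      also have "\<dots> = (card I / card X) / card X ^ (k - i - 1) * (\<Sum>z\<in>tuples k X. of_bool (take i x = take i z))"
        by (simp add: sum_distrib_left sum_divide_distrib mult.commute)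
      also have "(\<Sum>z\<in>tuples k X. of_bool (take i x = take i z) :: real) = card X ^ (k - i)"
        using sum_tuples_take[of X i k "\<lambda>v. of_bool (take i x = v)"] I i xi by (simp add: of_bool_def)
      also have "(card I / card X) / card X ^ (k - i - 1) * card X ^ (k - i) = real (card I)"
        using cX i by (simp add: Suc_diff_Suc[symmetric])
      finally show "(\<Sum>z\<in>tuples k X. \<Sum>y\<in>I. of_bool (take i x = take i z) * \<omega> y (x ! i) / card X ^ (k - i - 1))
        = real (card I)" .
    qed
    finally show ?thesis using I cX by (simp add: card_cartesian_product card_tuples)
  qed
  ultimately show ?thesis unfolding query_distribution_def
    using assms I nn ne
    by (auto intro!: divide_nonneg_nonneg mult_nonneg_nonneg simp: nth_tuples lessThan_empty_iff split_beta)
qed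

text \<open>For a fixed published value, the conditional distribution of block \<open>j\<close> is close to uniform for
  an average \<open>j\<close>, so the data structure for the block can complete its instance to a full one that
  publishes this value.\<close>

lemma hard_blocks:
  fixes K :: nat and \<tau> :: real
  assumes qd: "query_distribution I X \<omega>" and hard: "hard I X \<omega> f S w t 1 e"
    and K: "K > 0" and \<tau>: "\<tau> > 0"
  shows "hard (PiE {..<K} (\<lambda>_. I)) ({..<K} \<times> X) (\<lambda>Y (j, x). \<omega> (Y j) x / K) (\<lambda>Y (j, x). f (Y j) x)
    S w t B (e - (ln B / (K * \<tau>) + \<tau>))"
  unfolding hard_def
proof (intro allI impI, elim conjE)
  have I: "finite I" "I \<noteq> {}" "finite X" "X \<noteq> {}" and nn: "\<And>y x. y \<in> I \<Longrightarrow> x \<in> X \<Longrightarrow> 0 \<le> \<omega> y x"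
    and r: "\<And>y. y \<in> I \<Longrightarrow> (\<Sum>x\<in>X. \<omega> y x) = 1"
    using qd unfolding query_distribution_def by auto
  define P where "P = PiE {..<K} (\<lambda>_. I)"
  have P: "finite P" "P \<noteq> {}" using I by (auto simp: P_def finite_PiE PiE_eq_empty_iff)
  have cP: "card P > 0" using P by (simp add: card_gt_0_iff)
  have cPI: "card P = card I ^ K" by (simp add: P_def card_PiE)
  have cI: "card I > 0" using I by (simp add: card_gt_0_iff)
  have mem: "Y j \<in> I" if "Y \<in> P" "j < K" for Y j using that by (auto simp: P_def)
  fix M and \<pi> :: "(nat \<Rightarrow> 'a) \<Rightarrow> nat list" and q
  assume M: "\<forall>Y\<in>PiE {..<K} (\<lambda>_. I). \<forall>i<S. M Y i < 2 ^ w"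
    and q: "\<forall>Y\<in>PiE {..<K} (\<lambda>_. I). \<forall>x\<in>{..<K} \<times> X.
      set (probes (q (\<pi> Y) x) (M Y)) \<subseteq> {..<S} \<and> length (probes (q (\<pi> Y) x) (M Y)) \<le> t"
    and B: "card (\<pi> ` PiE {..<K} (\<lambda>_. I)) \<le> B"
  note M = M[folded P_def] and q = q[folded P_def] and B = B[folded P_def]
  define g where "g Y j = (\<Sum>x\<in>X. \<omega> (Y j) x * of_bool (result (q (\<pi> Y) (j, x)) (M Y) \<noteq> f (Y j) x))" for Y j
  define A where "A b = {Y \<in> P. \<pi> Y = b}" for b
  define def where "def b j = (\<Sum>y\<in>I. max 0 (1 / card I - card {Y \<in> A b. Y j = y} / card (A b)))" for b j
  have A: "A b \<subseteq> P" "finite (A b)" for b using P by (auto simp: A_def)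
  have claim: "e \<le> (\<Sum>Y\<in>A b. g Y j) / card (A b) + def b j" if b: "b \<in> \<pi> ` P" and j: "j < K" for b j
  proof -
    have Ane: "A b \<noteq> {}" using b by (auto simp: A_def)
    then have cA: "card (A b) > 0" using A by (simp add: card_gt_0_iff)
    \<comment> \<open>The completion of the block instance \<open>y\<close> is a member of
      \<open>A b\<close> with the least error on block \<open>j\<close>, hence at most the average
      over all completions. If \<open>y\<close> has no completion, any member of \<open>A b\<close>
      serves, and the deficit pays for its error.\<close>
    have "\<exists>Z\<in>A b. \<forall>Y\<in>A b. Y j = y \<longrightarrow> Z j = y \<and> g Z j \<le> g Y j" for y
    proof (cases "{Y \<in> A b. Y j = y} = {}")
      case True then show ?thesis using Ane by auto
    next
      case False
      then obtain Z where "is_arg_min (\<lambda>Y. g Y j) (\<lambda>Y. Y \<in> {Y \<in> A b. Y j = y}) Z"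
        using ex_is_arg_min_if_finite[of "{Y \<in> A b. Y j = y}" "\<lambda>Y. g Y j"] A(2) by auto
      then show ?thesis by (intro bexI[of _ Z]) (auto simp: is_arg_min_linorder)
    qed
    then obtain Z where Z: "\<And>y. Z y \<in> A b"
      "\<And>y Y. Y \<in> A b \<Longrightarrow> Y j = y \<Longrightarrow> Z y j = y \<and> g (Z y) j \<le> g Y j" by metis
    have ZP: "Z y \<in> P" "\<pi> (Z y) = b" for y using Z(1) by (auto simp: A_def)
    define G where "G y = (\<Sum>x\<in>X. \<omega> y x * of_bool (result (q b (j, x)) (M (Z y)) \<noteq> f y x))" for y
    have "e \<le> error I X \<omega> f (\<lambda>y. M (Z y)) (\<lambda>y. (\<lambda>_ x. q b (j, x)) [])"
    proof (rule hardD[OF hard, where \<pi> = "\<lambda>_. []"])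
      show "M (Z y) i < 2 ^ w" if "i < S" for y i using M ZP that by auto
      show "set (probes (q b (j, x)) (M (Z y))) \<subseteq> {..<S} \<and> length (probes (q b (j, x)) (M (Z y))) \<le> t"
        if "x \<in> X" for y x using q ZP(1)[of y] ZP(2)[of y] that j by fastforce
    qed (use I in \<open>auto simp: image_constant_conv\<close>)
    also have "\<dots> = (\<Sum>y\<in>I. G y) / card I" by (simp add: error_def G_def)
    also have "\<dots> = (\<Sum>y\<in>I. (1 / card I) * G y)" by (simp add: sum_divide_distrib)
    also have "\<dots> \<le> (\<Sum>y\<in>I. card {Y \<in> A b. Y j = y} / card (A b) * G y +
        max 0 (1 / card I - card {Y \<in> A b. Y j = y} / card (A b)))"
    proof (rule sum_mono)
      fix y assume y: "y \<in> I"
      have "G y \<le> (\<Sum>x\<in>X. \<omega> y x)" unfolding G_def using nn y by (intro sum_mono) auto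
      then have G: "G y \<le> 1" "0 \<le> G y" using r[OF y] nn y by (auto simp: G_def intro!: sum_nonneg)
      let ?d = "1 / card I - card {Y \<in> A b. Y j = y} / card (A b)"
      have "?d * G y \<le> max 0 ?d * G y" using G by (intro mult_right_mono) auto
      also have "\<dots> \<le> max 0 ?d * 1" using G by (intro mult_left_mono) auto
      finally show "1 / card I * G y \<le> card {Y \<in> A b. Y j = y} / card (A b) * G y + max 0 ?d"
        by (simp add: algebra_simps)
    qed
    also have "\<dots> = (\<Sum>y\<in>I. card {Y \<in> A b. Y j = y} * G y) / card (A b) + def b j"
      by (simp add: sum.distrib sum_divide_distrib def_def)
    also have "(\<Sum>y\<in>I. card {Y \<in> A b. Y j = y} * G y) = (\<Sum>Y\<in>A b. G (Y j))"
      using A j I by (intro sum_by_value mem) auto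
    also have "(\<Sum>Y\<in>A b. G (Y j)) / card (A b) \<le> (\<Sum>Y\<in>A b. g Y j) / card (A b)"
    proof (intro divide_right_mono sum_mono)
      fix Y assume Y: "Y \<in> A b"
      have "G (Y j) = g (Z (Y j)) j" using Z(2)[OF Y refl] ZP(2) by (simp add: G_def g_def)
      then show "G (Y j) \<le> g Y j" using Z(2)[OF Y refl] by simp
    qed auto
    finally show ?thesis by simp
  qed
  have claim2: "card (A b) * (K * e) \<le> (\<Sum>Y\<in>A b. \<Sum>j<K. g Y j) + card (A b) * ln (card P / card (A b)) / \<tau>
      + card (A b) * (K * \<tau>)" if b: "b \<in> \<pi> ` P" for b
  proof -
    have Ane: "A b \<noteq> {}" using b by (auto simp: A_def)
    then have cA: "card (A b) > 0" using A by (simp add: card_gt_0_iff)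
    have "K * e \<le> (\<Sum>j<K. (\<Sum>Y\<in>A b. g Y j) / card (A b) + def b j)"
      using sum_mono[of "{..<K}" "\<lambda>_. e", OF claim[OF b]] by simp
    also have "\<dots> = (\<Sum>Y\<in>A b. \<Sum>j<K. g Y j) / card (A b) + (\<Sum>j<K. def b j)"
      by (subst sum.swap) (simp add: sum.distrib sum_divide_distrib)
    also have "(\<Sum>j<K. def b j) \<le> ln (card P / card (A b)) / \<tau> + K * \<tau>"
      using sum_marginal_deficit_le[of I "A b" K \<tau>] I Ane \<tau> A(1)[of b, unfolded P_def]
      by (simp add: def_def cPI)
    finally have "card (A b) * (K * e) \<le> card (A b) * ((\<Sum>Y\<in>A b. \<Sum>j<K. g Y j) / card (A b)
        + (ln (card P / card (A b)) / \<tau> + K * \<tau>))" by (intro mult_left_mono) auto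
    then show ?thesis using cA by (simp add: distrib_left)
  qed
  have part: "(\<Sum>b\<in>\<pi> ` P. \<Sum>Y\<in>A b. h Y) = (\<Sum>Y\<in>P. h Y)" for h :: "(nat \<Rightarrow> 'a) \<Rightarrow> real"
    unfolding A_def using P by (intro sum.group) auto
  have cAP: "(\<Sum>b\<in>\<pi> ` P. real (card (A b))) = card P" using part[of "\<lambda>_. 1"] by simp
  \<comment> \<open>Averaged over the instances, \<open>ln (card P / card (A b))\<close> is the
    entropy of the published value.\<close>
  have ent: "(\<Sum>b\<in>\<pi> ` P. card (A b) * ln (card P / card (A b))) \<le> card P * ln B"
  proof -
    have "- (\<Sum>b\<in>\<pi> ` P. (card (A b) / card P) * ln (card (A b) / card P)) \<le> ln (card (\<pi> ` P))"
      using P cP cAP by (intro entropy_le_ln_card) (auto simp flip: sum_divide_distrib)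
    also have "\<dots> \<le> ln B"
    proof -
      have "card (\<pi> ` P) > 0" using P by (simp add: card_gt_0_iff)
      then show ?thesis using B by simp
    qed
    finally have le: "- (\<Sum>b\<in>\<pi> ` P. (card (A b) / card P) * ln (card (A b) / card P)) \<le> ln B" .
    have "(\<Sum>b\<in>\<pi> ` P. card (A b) * ln (card P / card (A b)))
        = (\<Sum>b\<in>\<pi> ` P. card P * - ((card (A b) / card P) * ln (card (A b) / card P)))"
    proof (intro sum.cong refl)
      fix b assume "b \<in> \<pi> ` P"
      then have "card (A b) > 0" using A by (auto simp: A_def card_gt_0_iff)
      then show "card (A b) * ln (card P / card (A b)) = card P * - ((card (A b) / card P) * ln (card (A b) / card P))"
        using cP by (simp add: ln_div algebra_simps)
    qed
    also have "\<dots> = card P * - (\<Sum>b\<in>\<pi> ` P. (card (A b) / card P) * ln (card (A b) / card P))"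
      by (simp only: sum_negf[symmetric] sum_distrib_left)
    also have "\<dots> \<le> card P * ln B" using le by (intro mult_left_mono) auto
    finally show ?thesis .
  qed
  have "(\<Sum>b\<in>\<pi> ` P. card (A b) * (K * e)) \<le> (\<Sum>b\<in>\<pi> ` P. (\<Sum>Y\<in>A b. \<Sum>j<K. g Y j)
      + card (A b) * ln (card P / card (A b)) / \<tau> + card (A b) * (K * \<tau>))"
    by (intro sum_mono claim2)
  then have "card P * (K * e) \<le> (\<Sum>Y\<in>P. \<Sum>j<K. g Y j)
      + (\<Sum>b\<in>\<pi> ` P. card (A b) * ln (card P / card (A b))) / \<tau> + card P * (K * \<tau>)"
    by (simp only: sum.distrib part cAP flip: sum_distrib_right sum_divide_distrib)
  also have "\<dots> \<le> (\<Sum>Y\<in>P. \<Sum>j<K. g Y j) + card P * ln B / \<tau> + card P * (K * \<tau>)"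
    using ent \<tau> by (intro add_mono divide_right_mono) auto
  finally have "card P * K * e / (card P * K) \<le>
      ((\<Sum>Y\<in>P. \<Sum>j<K. g Y j) + card P * ln B / \<tau> + card P * (K * \<tau>)) / (card P * K)"
    by (intro divide_right_mono) (auto simp: mult.assoc)
  then have "e \<le> (\<Sum>Y\<in>P. \<Sum>j<K. g Y j) / (card P * K) + (ln B / (K * \<tau>) + \<tau>)"
    using cP K \<tau> by (simp add: add_divide_distrib mult.commute)
  moreover have "error P ({..<K} \<times> X) (\<lambda>Y (j, x). \<omega> (Y j) x / K) (\<lambda>Y (j, x). f (Y j) x) M (\<lambda>Y. q (\<pi> Y))
      = (\<Sum>Y\<in>P. \<Sum>j<K. g Y j) / (card P * K)"
    by (simp add: error_def g_def sum.cartesian_product split_beta sum_divide_distrib mult.commute)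
  ultimately show "e - (ln B / (K * \<tau>) + \<tau>) \<le> error (PiE {..<K} (\<lambda>_. I)) ({..<K} \<times> X)
    (\<lambda>Y (j, x). \<omega> (Y j) x / K) (\<lambda>Y (j, x). f (Y j) x) M (\<lambda>Y. q (\<pi> Y))"
    unfolding P_def by simp
qed

section \<open>Saving the first probe\<close>

definition first_cell :: "probe_tree \<Rightarrow> nat" where
  "first_cell q = (case q of Answer _ \<Rightarrow> 0 | Probe i _ \<Rightarrow> i)"

text \<open>The contents are published modulo \<open>2 ^ w\<close> because \<open>G\<close> may contain the dummy cell \<open>0\<close> of an
  immediate answer, which lies outside the table if \<open>S = 0\<close>.\<close>

lemma skip_first_probe:
  fixes q :: probe_tree
  assumes M: "\<And>y i. y \<in> I \<Longrightarrow> i < S \<Longrightarrow> M y i < 2 ^ w" and I: "I \<noteq> {}"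
    and q: "\<And>y. y \<in> I \<Longrightarrow> set (probes q (M y)) \<subseteq> {..<S} \<and> length (probes q (M y)) \<le> Suc t"
    and G: "first_cell q \<in> set G"
  shows "\<exists>q'. \<forall>y\<in>I. result (q' (map (\<lambda>c. M y c mod 2 ^ w) G)) (M y) = result q (M y) \<and>
    set (probes (q' (map (\<lambda>c. M y c mod 2 ^ w) G)) (M y)) \<subseteq> {..<S} \<and>
    length (probes (q' (map (\<lambda>c. M y c mod 2 ^ w) G)) (M y)) \<le> t"
proof (cases q)
  case (Answer c)
  then show ?thesis by (intro exI[of _ "\<lambda>_. q"]) simp
next
  case (Probe i h)
  then obtain j where j: "j < length G" "G ! j = i" using G by (auto simp: first_cell_def in_set_conv_nth)
  have "i < S" using q I Probe by auto
  then have "map (\<lambda>c. M y c mod 2 ^ w) G ! j = M y i" if "y \<in> I" for y using M[OF that] j by simp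
  then show ?thesis using q Probe by (intro exI[of _ "\<lambda>vs. h (vs ! j)"]) auto
qed

text \<open>After the digits before position \<open>i\<close> are fixed, the query digit at position \<open>i\<close> may be completed
  by any later digits. They are chosen such that the first probe goes to one of \<open>N\<close> fixed cells,
  whose contents are then published.\<close>

lemma hard_prefix:
  assumes qd: "query_distribution I X \<omega>" and hard: "hard I X \<omega> f S w t (2 ^ (w * N)) e"
    and k: "k > 0" and R: "R \<ge> 1" "ln R > 1"
  shows "hard ({..<k} \<times> tuples k X \<times> I) (tuples k X)
    (\<lambda>(i, z, y) x. of_bool (take i x = take i z) * \<omega> y (x ! i) / card X ^ (k - i - 1))
    (\<lambda>(i, z, y) x. f y (x ! i)) S w (Suc t) 1
    (e - (2 * ln (real S + 1) / (k * (ln R - 1)) + (1 - 1 / (2 * R)) ^ N))"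
  unfolding hard_def
proof (intro allI impI, elim conjE)
  have I: "finite I" "I \<noteq> {}" "finite X" "X \<noteq> {}" and nn: "\<And>y x. y \<in> I \<Longrightarrow> x \<in> X \<Longrightarrow> 0 \<le> \<omega> y x"
    and r: "\<And>y. y \<in> I \<Longrightarrow> (\<Sum>x\<in>X. \<omega> y x) = 1" and c: "\<And>x. x \<in> X \<Longrightarrow> (\<Sum>y\<in>I. \<omega> y x) = card I / card X"
    using qd unfolding query_distribution_def by auto
  have cI: "card I > 0" and cX: "card X > 0" using I by (simp_all add: card_gt_0_iff)
  define J where "J = {..<k} \<times> tuples k X \<times> I"
  define \<omega>' where "\<omega>' = (\<lambda>(i, z, y) x. of_bool (take i x = take i z) * \<omega> y (x ! i) / card X ^ (k - i - 1))"
  define f' where "f' = (\<lambda>(i :: nat, z :: 'b list, y) x. f y (x ! i))"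
  have qd': "query_distribution J (tuples k X) \<omega>'"
    using query_distribution_prefix[OF qd k] by (simp add: J_def \<omega>'_def)
  then have Jne: "J \<noteq> {}" "finite J" by (auto simp: query_distribution_def)
  fix M and \<pi> :: "nat \<times> 'b list \<times> 'a \<Rightarrow> nat list" and q
  assume M: "\<forall>y\<in>{..<k} \<times> tuples k X \<times> I. \<forall>i<S. M y i < 2 ^ w"
    and q: "\<forall>y\<in>{..<k} \<times> tuples k X \<times> I. \<forall>x\<in>tuples k X.
      set (probes (q (\<pi> y) x) (M y)) \<subseteq> {..<S} \<and> length (probes (q (\<pi> y) x) (M y)) \<le> Suc t"
    and B: "card (\<pi> ` ({..<k} \<times> tuples k X \<times> I)) \<le> 1"
  note M = M[folded J_def] and q = q[folded J_def] and B = B[folded J_def]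
  \<comment> \<open>A single published value carries no information, so the tree and with it the
    first cell depend on the query string only.\<close>
  obtain b where b: "\<And>y. y \<in> J \<Longrightarrow> \<pi> y = b"
    using B Jne card_le_Suc0_iff_eq[of "\<pi> ` J"] by (metis One_nat_def finite_imageI imageI)
  define tr where "tr x = q b x" for x
  have tr: "set (probes (tr x) (M y)) \<subseteq> {..<S} \<and> length (probes (tr x) (M y)) \<le> Suc t"
    if "y \<in> J" "x \<in> tuples k X" for x y using q b that by (metis tr_def)
  define cell where "cell x = first_cell (tr x)" for x
  define C where "C = insert 0 {..<S}"
  have C: "finite C" "card C \<le> S + 1" "C \<noteq> {}" by (auto simp: C_def card_insert_if)
  have cell: "cell x \<in> C" if "x \<in> tuples k X" for x
    using tr[OF _ that] Jne by (auto simp: cell_def first_cell_def C_def split: probe_tree.split)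
  \<comment> \<open>This is the distribution of the first cell when the prefix \<open>v\<close> is
    continued by uniform digits; cell 0 in \<open>C\<close> also stands for an immediate
    answer.\<close>
  define \<mu> where "\<mu> v c = card {s \<in> tuples (k - length v) X. cell (v @ s) = c} / real (card X ^ (k - length v))" for v c
  have ap: "v @ s \<in> tuples k X" if "v \<in> tuples i X" "s \<in> tuples (k - i) X" "i \<le> k" for v s i
    using append_tuples[OF that(1,2)] that(3) by simp
  have total: "(\<Sum>c\<in>C. \<mu> v c) = 1" if "i \<le> k" "v \<in> tuples i X" for i v
  proof -
    have l: "length v = i" using that by (simp add: tuples_def)
    have "(\<Sum>c\<in>C. real (card {s \<in> tuples (k - i) X. cell (v @ s) = c}) * 1) = (\<Sum>s\<in>tuples (k - i) X. 1::real)"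
      using C I ap[OF that(2) _ that(1)] cell by (intro sum_by_value) auto
    then show ?thesis using I cX l by (simp add: \<mu>_def card_tuples flip: sum_divide_distrib)
  qed
  have avg: "\<mu> v c = (\<Sum>u\<in>X. \<mu> (v @ [u]) c) / card X" if "i < k" "v \<in> tuples i X" for i v c
  proof -
    have l: "length v = i" using that by (simp add: tuples_def)
    have "real (card {s \<in> tuples (k - i) X. cell (v @ s) = c}) = (\<Sum>s\<in>tuples (Suc 0 + (k - i - 1)) X. of_bool (cell (v @ s) = c))"
      using I that by (simp add: sum_of_bool_eq Int_def Suc_diff_Suc)
    also have "\<dots> = (\<Sum>u\<in>X. real (card {s \<in> tuples (k - i - 1) X. cell (v @ u # s) = c}))"
      unfolding sum_tuples_append sum_tuples_1 using I by (simp add: sum_of_bool_eq Int_def)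
    finally show ?thesis using l that
      by (simp add: \<mu>_def Suc_diff_Suc[symmetric] mult.commute flip: sum_divide_distrib)
  qed
  define pen where "pen i z = (\<Sum>u\<in>X. \<Sum>c\<in>C. max 0 (\<mu> (take i z @ [u]) c - R * \<mu> (take i z) c)) / card X" for i z
  define err where "err i z = (\<Sum>y\<in>I. \<Sum>x\<in>tuples k X. \<omega>' (i, z, y) x *
    of_bool (result (tr x) (M (i, z, y)) \<noteq> f y (x ! i))) / card I" for i z
  define fail where "fail = (1 - 1 / (2 * R)) ^ N"
  have claim: "e \<le> err i z + 2 * pen i z + fail" if iz: "i < k" "z \<in> tuples k X" for i z
  proof -
    define v where "v = take i z"
    have v: "v \<in> tuples i X" "length v = i" using take_tuples[OF iz(2), of i] iz by (auto simp: v_def tuples_def)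
    define T where "T = tuples (k - i - 1) X"
    have vus: "v @ u # s \<in> tuples k X" if "u \<in> X" "s \<in> T" for u s
      using that v iz by (auto simp: T_def tuples_def)
    have T: "finite T" "card T = card X ^ (k - i - 1)" using I by (auto simp: T_def card_tuples)
    have mem: "(i, z, y) \<in> J" if "y \<in> I" for y using that iz by (simp add: J_def)
    \<comment> \<open>The digit \<open>u\<close> has marginal probability \<open>1 / card X\<close>,
      so the factor \<open>card X / card I\<close> turns the sum into the error probability
      conditioned on \<open>u\<close>.\<close>
    define loss where "loss u h = (card X / card I) * (\<Sum>y\<in>I. \<omega> y u * of_bool (h (M (i, z, y)) \<noteq> f y u))" for u and h :: "(nat \<Rightarrow> nat) \<Rightarrow> color"
    have loss: "0 \<le> loss u h \<and> loss u h \<le> 1" if "u \<in> X" for u h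
    proof
      show "0 \<le> loss u h" using nn that unfolding loss_def by (intro mult_nonneg_nonneg sum_nonneg) auto
      have "loss u h \<le> (card X / card I) * (\<Sum>y\<in>I. \<omega> y u)"
        unfolding loss_def using nn that by (intro mult_left_mono sum_mono) auto
      then show "loss u h \<le> 1" using c[OF that] cX cI by simp
    qed
    define E where "E u s = loss u (result (tr (v @ u # s)))" for u s
    define fib where "fib u c = {s \<in> T. cell (v @ u # s) = c}" for u c
    have fib: "finite (fib u c)" for u c using T by (simp add: fib_def)
    \<comment> \<open>The minimum allows one completion to be fixed per digit and cell, while the
      average of \<open>zz u\<close> under \<open>\<mu> (v @ [u])\<close> remains below the average
      error over all completions.\<close>
    define zz where "zz u c = (if fib u c = {} then 1 else Min (E u ` fib u c))" for u c
    have zz01: "0 \<le> zz u c \<and> zz u c \<le> 1" if "u \<in> X" for u c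
    proof (cases "fib u c = {}")
      case False
      then have "Min (E u ` fib u c) \<in> E u ` fib u c" using fib by (intro Min_in) auto
      then show ?thesis using False loss[OF that] by (auto simp: zz_def E_def)
    qed (simp add: zz_def)
    have zzE: "zz u (cell (v @ u # s)) \<le> E u s" if "s \<in> T" for u s
      using that fib by (auto simp: zz_def fib_def)
    have fibcard: "\<mu> (v @ [u]) c = card (fib u c) / card X ^ (k - i - 1)" for u c
      using v by (simp add: \<mu>_def fib_def T_def)
    have child: "v @ [u] \<in> tuples (Suc i) X" if "u \<in> X" for u
      using that v by (auto simp: tuples_def)
    have "\<exists>G. length G = N \<and> set G \<subseteq> C \<and>
      (\<Sum>u\<in>X. best (zz u) G) \<le> (\<Sum>u\<in>X. (\<Sum>c\<in>C. \<mu> (v @ [u]) c * zz u c)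
        + 2 * (\<Sum>c\<in>C. max 0 (\<mu> (v @ [u]) c - R * \<mu> v c))) + (1 - 1 / (2 * R)) ^ N * card X"
    proof (rule sampling_list)
      show "(\<Sum>c\<in>C. \<mu> (v @ [u]) c) = 1" if "u \<in> X" for u
        using total[of "Suc i"] child[OF that] iz by simp
    qed (use C(1) I(3,4) avg[OF iz(1) v(1)] R(1) zz01 in \<open>auto simp: \<mu>_def\<close>)
    then obtain G where G: "length G = N" "set G \<subseteq> C"
      "(\<Sum>u\<in>X. best (zz u) G) \<le> (\<Sum>u\<in>X. (\<Sum>c\<in>C. \<mu> (v @ [u]) c * zz u c)
        + 2 * (\<Sum>c\<in>C. max 0 (\<mu> (v @ [u]) c - R * \<mu> v c))) + (1 - 1 / (2 * R)) ^ N * card X"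
      by blast
    define pub where "pub y = map (\<lambda>c. M (i, z, y) c mod 2 ^ w) G" for y
    define good where "good u q' \<longleftrightarrow> (\<forall>y\<in>I. set (probes (q' (pub y)) (M (i, z, y))) \<subseteq> {..<S} \<and>
        length (probes (q' (pub y)) (M (i, z, y))) \<le> t) \<and>
        (card X / card I) * (\<Sum>y\<in>I. \<omega> y u * of_bool (result (q' (pub y)) (M (i, z, y)) \<noteq> f y u))
          \<le> best (zz u) G" for u q'
    have "\<exists>q'. good u q'" if u: "u \<in> X" for u
    proof (cases "best (zz u) G = 1")
      case True
      then show ?thesis using loss[OF u, of "\<lambda>_. Red"]
        by (intro exI[of _ "\<lambda>_. Answer Red"]) (simp add: loss_def good_def)
    next
      case False
      then obtain c where c: "c \<in> set G" "best (zz u) G = zz u c" using best_attained by metis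
      with False have ne: "fib u c \<noteq> {}" by (auto simp: zz_def)
      then have "Min (E u ` fib u c) \<in> E u ` fib u c" using fib by (intro Min_in) auto
      moreover have "best (zz u) G = Min (E u ` fib u c)" using c(2) ne by (simp add: zz_def)
      ultimately obtain s where "s \<in> fib u c" "best (zz u) G = E u s" by auto
      then have s: "s \<in> T" "cell (v @ u # s) = c" "best (zz u) G = E u s" by (simp_all add: fib_def)
      have "\<exists>q'. \<forall>y\<in>I. result (q' (map (\<lambda>c. M (i, z, y) c mod 2 ^ w) G)) (M (i, z, y)) = result (tr (v @ u # s)) (M (i, z, y)) \<and>
        set (probes (q' (map (\<lambda>c. M (i, z, y) c mod 2 ^ w) G)) (M (i, z, y))) \<subseteq> {..<S} \<and>
        length (probes (q' (map (\<lambda>c. M (i, z, y) c mod 2 ^ w) G)) (M (i, z, y))) \<le> t"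
        using M mem tr vus[OF u s(1)] s(2) c(1) I
        by (intro skip_first_probe[where M = "\<lambda>y. M (i, z, y)"]) (auto simp: cell_def)
      then obtain q' where q': "\<And>y. y \<in> I \<Longrightarrow> result (q' (pub y)) (M (i, z, y)) = result (tr (v @ u # s)) (M (i, z, y)) \<and>
        set (probes (q' (pub y)) (M (i, z, y))) \<subseteq> {..<S} \<and> length (probes (q' (pub y)) (M (i, z, y))) \<le> t"
        unfolding pub_def by blast
      have "(\<Sum>y\<in>I. \<omega> y u * of_bool (result (q' (pub y)) (M (i, z, y)) \<noteq> f y u))
        = (\<Sum>y\<in>I. \<omega> y u * of_bool (result (tr (v @ u # s)) (M (i, z, y)) \<noteq> f y u))"
        using q' by (intro sum.cong) auto
      then show ?thesis using q' s(3) by (intro exI[of _ q']) (auto simp: E_def loss_def good_def)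
    qed
    then obtain q' where "\<And>u. u \<in> X \<Longrightarrow> good u (q' u)" by metis
    then have q': "\<And>u y. u \<in> X \<Longrightarrow> y \<in> I \<Longrightarrow> set (probes (q' u (pub y)) (M (i, z, y))) \<subseteq> {..<S} \<and>
        length (probes (q' u (pub y)) (M (i, z, y))) \<le> t"
      "\<And>u. u \<in> X \<Longrightarrow> (card X / card I) * (\<Sum>y\<in>I. \<omega> y u * of_bool (result (q' u (pub y)) (M (i, z, y)) \<noteq> f y u))
          \<le> best (zz u) G" unfolding good_def by auto
    have "e \<le> error I X \<omega> f (\<lambda>y. M (i, z, y)) (\<lambda>y. (\<lambda>p x. q' x p) (pub y))"
    proof (rule hardD[OF hard])
      have "pub ` I \<subseteq> tuples N {..<2 ^ w}" using G(1) by (auto simp: pub_def tuples_def)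
      then have "card (pub ` I) \<le> card (tuples N {..<2 ^ w :: nat})" by (intro card_mono) auto
      then show "card (pub ` I) \<le> 2 ^ (w * N)" by (simp add: card_tuples power_mult)
    qed (use M mem q' in auto)
    also have "\<dots> = (\<Sum>u\<in>X. (card X / card I) *
        (\<Sum>y\<in>I. \<omega> y u * of_bool (result (q' u (pub y)) (M (i, z, y)) \<noteq> f y u))) / card X"
      unfolding error_def using cX by (subst sum.swap) (simp flip: sum_distrib_left sum_divide_distrib)
    also have "\<dots> \<le> (\<Sum>u\<in>X. best (zz u) G) / card X"
      using q'(2) by (intro divide_right_mono sum_mono) auto
    also have "\<dots> \<le> ((\<Sum>u\<in>X. (\<Sum>c\<in>C. \<mu> (v @ [u]) c * zz u c)
        + 2 * (\<Sum>c\<in>C. max 0 (\<mu> (v @ [u]) c - R * \<mu> v c))) + (1 - 1 / (2 * R)) ^ N * card X) / card X"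
      using G(3) by (intro divide_right_mono) auto
    also have "\<dots> = (\<Sum>u\<in>X. \<Sum>c\<in>C. \<mu> (v @ [u]) c * zz u c) / card X + 2 * pen i z + fail"
      using cX by (simp add: add_divide_distrib sum.distrib pen_def fail_def v_def flip: sum_distrib_left)
    also have "(\<Sum>u\<in>X. \<Sum>c\<in>C. \<mu> (v @ [u]) c * zz u c) \<le> (\<Sum>u\<in>X. (\<Sum>s\<in>T. E u s) / card X ^ (k - i - 1))"
    proof (rule sum_mono)
      fix u assume u: "u \<in> X"
      have "(\<Sum>c\<in>C. \<mu> (v @ [u]) c * zz u c) = (\<Sum>c\<in>C. card (fib u c) * zz u c) / card X ^ (k - i - 1)"
        by (simp add: fibcard sum_divide_distrib)
      also have "(\<Sum>c\<in>C. card (fib u c) * zz u c) = (\<Sum>s\<in>T. zz u (cell (v @ u # s)))"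
        unfolding fib_def using T C cell vus[OF u] by (intro sum_by_value) auto
      also have "\<dots> / card X ^ (k - i - 1) \<le> (\<Sum>s\<in>T. E u s) / card X ^ (k - i - 1)"
        using zzE by (intro divide_right_mono sum_mono) auto
      finally show "(\<Sum>c\<in>C. \<mu> (v @ [u]) c * zz u c) \<le> (\<Sum>s\<in>T. E u s) / card X ^ (k - i - 1)" .
    qed
    also have "(\<Sum>u\<in>X. (\<Sum>s\<in>T. E u s) / card X ^ (k - i - 1)) / card X = err i z"
    proof -
      have "(\<Sum>x\<in>tuples k X. \<omega>' (i, z, y) x * of_bool (result (tr x) (M (i, z, y)) \<noteq> f y (x ! i)))
        = (\<Sum>u\<in>X. \<Sum>s\<in>T. \<omega> y u * of_bool (result (tr (v @ u # s)) (M (i, z, y)) \<noteq> f y u)) / card X ^ (k - i - 1)"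
        (is "_ = ?W y") for y
      proof -
        have "(\<Sum>x\<in>tuples k X. \<omega>' (i, z, y) x * of_bool (result (tr x) (M (i, z, y)) \<noteq> f y (x ! i)))
          = (\<Sum>v'\<in>tuples i X. if v' = v then ?W y else 0)"
          unfolding sum_tuples_split[OF iz(1)] sum_divide_distrib
          by (intro sum.cong refl) (auto simp: tuples_def nth_append \<omega>'_def v_def T_def intro!: sum.cong)
        then show ?thesis using v I by simp
      qed
      then have "err i z = (\<Sum>y\<in>I. ?W y) / card I" by (simp add: err_def)
      also have "(\<Sum>y\<in>I. ?W y) = (\<Sum>u\<in>X. \<Sum>s\<in>T. \<Sum>y\<in>I. \<omega> y u * of_bool (result (tr (v @ u # s)) (M (i, z, y)) \<noteq> f y u)) / card X ^ (k - i - 1)"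
        by (simp add: sum.swap[of _ _ I] flip: sum_divide_distrib)
      also have "\<dots> / card I = (\<Sum>u\<in>X. (\<Sum>s\<in>T. E u s) / card X ^ (k - i - 1)) / card X"
        using cX by (simp add: E_def loss_def flip: sum_distrib_left sum_divide_distrib)
      finally show ?thesis by simp
    qed
    finally show ?thesis by (simp add: divide_right_mono)
  qed
  have pen: "(ln R - 1) * (\<Sum>i<k. \<Sum>z\<in>tuples k X. pen i z) \<le> card X ^ k * ln (real S + 1)"
  proof -
    have "(ln R - 1) * (\<Sum>i<k. \<Sum>z\<in>tuples k X. pen i z) \<le> card X ^ k * ln (card C)"
      unfolding pen_def using C I R total avg by (intro sum_prefix_excess_le) (auto simp: \<mu>_def)
    also have "\<dots> \<le> card X ^ k * ln (real S + 1)"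
      using C by (intro mult_left_mono) (auto simp: card_gt_0_iff)
    finally show ?thesis .
  qed
  define V where "V = real k * card X ^ k"
  have V: "V > 0" using k cX by (simp add: V_def)
  have "V * e = (\<Sum>i<k. \<Sum>z\<in>tuples k X. e)" using I by (simp add: V_def card_tuples)
  also have "\<dots> \<le> (\<Sum>i<k. \<Sum>z\<in>tuples k X. err i z + 2 * pen i z + fail)"
    by (intro sum_mono claim) auto
  also have "\<dots> = (\<Sum>i<k. \<Sum>z\<in>tuples k X. err i z) + 2 * (\<Sum>i<k. \<Sum>z\<in>tuples k X. pen i z) + V * fail"
    using I by (simp add: sum.distrib V_def card_tuples flip: sum_distrib_left)
  also have "(\<Sum>i<k. \<Sum>z\<in>tuples k X. pen i z) \<le> card X ^ k * ln (real S + 1) / (ln R - 1)"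
    using pen R by (simp add: pos_le_divide_eq mult.commute)
  finally have "V * e / V \<le> ((\<Sum>i<k. \<Sum>z\<in>tuples k X. err i z) + 2 * (card X ^ k * ln (real S + 1) / (ln R - 1)) + V * fail) / V"
    using V by (intro divide_right_mono) auto
  then have "e \<le> (\<Sum>i<k. \<Sum>z\<in>tuples k X. err i z) / V + (2 * ln (real S + 1) / (k * (ln R - 1)) + fail)"
    using V cX k by (simp add: add_divide_distrib V_def mult.commute)
  moreover have "error J (tuples k X) \<omega>' f' M (\<lambda>y. q (\<pi> y)) = (\<Sum>i<k. \<Sum>z\<in>tuples k X. err i z) / V"
  proof -
    have "error J (tuples k X) \<omega>' f' M (\<lambda>y. q (\<pi> y)) =
      (\<Sum>(i, z, y)\<in>J. \<Sum>x\<in>tuples k X. \<omega>' (i, z, y) x * of_bool (result (tr x) (M (i, z, y)) \<noteq> f y (x ! i))) / card J"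
      unfolding error_def by (intro arg_cong2[where f = "(/)"] sum.cong refl) (auto simp: b f'_def tr_def)
    also have "(\<Sum>(i, z, y)\<in>J. \<Sum>x\<in>tuples k X. \<omega>' (i, z, y) x * of_bool (result (tr x) (M (i, z, y)) \<noteq> f y (x ! i)))
      = (\<Sum>i<k. \<Sum>z\<in>tuples k X. card I * err i z)"
    proof -
      have "(\<Sum>(i, z, y)\<in>J. h i z y) = (\<Sum>i<k. \<Sum>z\<in>tuples k X. \<Sum>y\<in>I. h i z y)" for h :: "nat \<Rightarrow> 'b list \<Rightarrow> 'a \<Rightarrow> real"
        by (simp add: J_def sum.cartesian_product)
      then show ?thesis using cI by (simp add: err_def)
    qed
    also have "real (card J) = V * card I" using I by (simp add: J_def V_def card_cartesian_product card_tuples)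
    finally show ?thesis using cI by (simp flip: sum_distrib_left)
  qed
  ultimately show "e - (2 * ln (real S + 1) / (k * (ln R - 1)) + (1 - 1 / (2 * R)) ^ N)
    \<le> error ({..<k} \<times> tuples k X \<times> I) (tuples k X)
      (\<lambda>(i, z, y) x. of_bool (take i x = take i z) * \<omega> y (x ! i) / card X ^ (k - i - 1))
      (\<lambda>(i, z, y) x. f y (x ! i)) M (\<lambda>y. q (\<pi> y))"
    unfolding J_def[symmetric] \<omega>'_def[symmetric] f'_def[symmetric] fail_def[symmetric] by simp
qed

section \<open>Encoding as predecessor problems\<close>

lemma hard_reindex:
  assumes inj: "inj_on \<phi> I" "inj_on \<psi> X" and hard: "hard I X \<omega> f S w t B e"
  shows "hard (\<phi> ` I) (\<psi> ` X) (\<lambda>y x. \<omega> (inv_into I \<phi> y) (inv_into X \<psi> x))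
    (\<lambda>y x. f (inv_into I \<phi> y) (inv_into X \<psi> x)) S w t B e"
  unfolding hard_def
proof (intro allI impI, elim conjE)
  fix M and \<pi> :: "_ \<Rightarrow> nat list" and q
  assume M: "\<forall>y\<in>\<phi> ` I. \<forall>i<S. M y i < 2 ^ w"
    and q: "\<forall>y\<in>\<phi> ` I. \<forall>x\<in>\<psi> ` X. set (probes (q (\<pi> y) x) (M y)) \<subseteq> {..<S} \<and> length (probes (q (\<pi> y) x) (M y)) \<le> t"
    and B: "card (\<pi> ` \<phi> ` I) \<le> B"
  have "e \<le> error I X \<omega> f (\<lambda>y. M (\<phi> y)) (\<lambda>y. (\<lambda>p x. q p (\<psi> x)) ((\<pi> \<circ> \<phi>) y))"
    by (rule hardD[OF hard]) (use M q B in \<open>auto simp: image_comp\<close>)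
  also have "\<dots> = error (\<phi> ` I) (\<psi> ` X) (\<lambda>y x. \<omega> (inv_into I \<phi> y) (inv_into X \<psi> x))
    (\<lambda>y x. f (inv_into I \<phi> y) (inv_into X \<psi> x)) M (\<lambda>y. q (\<pi> y))"
    using inj by (simp add: error_def sum.reindex card_image)
  finally show "e \<le> error (\<phi> ` I) (\<psi> ` X) (\<lambda>y x. \<omega> (inv_into I \<phi> y) (inv_into X \<psi> x))
    (\<lambda>y x. f (inv_into I \<phi> y) (inv_into X \<psi> x)) M (\<lambda>y. q (\<pi> y))" .
qed

lemma query_distribution_reindex:
  assumes inj: "inj_on \<phi> I" "inj_on \<psi> X" and qd: "query_distribution I X \<omega>"
  shows "query_distribution (\<phi> ` I) (\<psi> ` X) (\<lambda>y x. \<omega> (inv_into I \<phi> y) (inv_into X \<psi> x))"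
  using assms unfolding query_distribution_def by (simp add: sum.reindex card_image)

text \<open>Only pairs of nonzero weight are constrained: a query that leaves the prefix of the
  instance may have a predecessor of the wrong color or none. The size \<open>U\<close> is
  arbitrary, not a power of two, so that universes multiply exactly.\<close>

definition encodes ::
  "'i set \<Rightarrow> 'q set \<Rightarrow> ('i \<Rightarrow> 'q \<Rightarrow> real) \<Rightarrow> ('i \<Rightarrow> 'q \<Rightarrow> color) \<Rightarrow> nat \<Rightarrow> nat \<Rightarrow>
    ('i \<Rightarrow> nat \<rightharpoonup> color) \<Rightarrow> ('q \<Rightarrow> nat) \<Rightarrow> bool" where
  "encodes I X \<omega> f n U enc num \<longleftrightarrow>
    (\<forall>y\<in>I. dom (enc y) \<subseteq> {..<U} \<and> card (dom (enc y)) = n) \<and> (\<forall>x\<in>X. num x < U) \<and>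
    (\<forall>y\<in>I. \<forall>x\<in>X. \<omega> y x \<noteq> 0 \<longrightarrow>
      (\<exists>z\<in>dom (enc y). z \<le> num x) \<and> pred_color (enc y) (num x) = f y x)"

text \<open>Instances and queries are natural numbers, to keep the recursive construction within one type.\<close>

definition hard_predecessor :: "nat \<Rightarrow> nat \<Rightarrow> nat \<Rightarrow> nat \<Rightarrow> nat \<Rightarrow> nat \<Rightarrow> real \<Rightarrow> bool" where
  "hard_predecessor n U S w t B e \<longleftrightarrow>
    (\<exists>(I :: nat set) (X :: nat set) \<omega> f enc num.
      query_distribution I X \<omega> \<and> hard I X \<omega> f S w t B e \<and> encodes I X \<omega> f n U enc num)"

text \<open>Finite index sets embed into the natural numbers, which brings the products and function
  spaces of the two constructions back to one type.\<close>

lemma hard_predecessorI: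
  assumes qd: "query_distribution I X \<omega>" and hard: "hard I X \<omega> f S w t B e"
    and enc: "encodes I X \<omega> f n U enc num"
  shows "hard_predecessor n U S w t B e"
proof -
  have "finite I" "finite X" using qd by (auto simp: query_distribution_def)
  then obtain \<phi> \<psi> :: "_ \<Rightarrow> nat" where inj: "inj_on \<phi> I" "inj_on \<psi> X"
    using finite_imp_inj_to_nat_seg by metis
  have "encodes (\<phi> ` I) (\<psi> ` X) (\<lambda>y x. \<omega> (inv_into I \<phi> y) (inv_into X \<psi> x))
    (\<lambda>y x. f (inv_into I \<phi> y) (inv_into X \<psi> x)) n U (\<lambda>y. enc (inv_into I \<phi> y)) (\<lambda>x. num (inv_into X \<psi> x))"
    using enc inj unfolding encodes_def by simp
  then show ?thesis
    unfolding hard_predecessor_def using hard_reindex[OF inj hard] query_distribution_reindex[OF inj qd] by blast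
qed

lemma pred_color_eqI:
  assumes "Y m = Some c" "m \<le> x" "\<And>z. z \<in> dom Y \<Longrightarrow> z \<le> x \<Longrightarrow> z \<le> m"
  shows "pred_color Y x = c"
proof -
  have "finite {y \<in> dom Y. y \<le> x}" by (rule finite_subset[of _ "{..x}"]) auto
  then have "Max {y \<in> dom Y. y \<le> x} = m" using assms by (intro Max_eqI) auto
  then show ?thesis using assms by (simp add: pred_color_def)
qed

lemma predecessorE:
  assumes "\<exists>z\<in>dom Y. z \<le> x"
  obtains m c where "Y m = Some c" "m \<le> x" "\<And>z. z \<in> dom Y \<Longrightarrow> z \<le> x \<Longrightarrow> z \<le> m" "pred_color Y x = c"
proof -
  have fin: "finite {y \<in> dom Y. y \<le> x}" by (rule finite_subset[of _ "{..x}"]) auto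
  have "Max {y \<in> dom Y. y \<le> x} \<in> {y \<in> dom Y. y \<le> x}" using assms fin by (intro Max_in) auto
  then obtain c where "Y (Max {y \<in> dom Y. y \<le> x}) = Some c" "Max {y \<in> dom Y. y \<le> x} \<le> x" by auto
  then show thesis using fin by (intro that[of "Max {y \<in> dom Y. y \<le> x}" c]) (auto simp: pred_color_def)
qed

lemma mult_add_less: "a * U + b < m * U" if "a < m" "b < U" for a b m U :: nat
proof -
  have "(a + 1) * U \<le> m * U" using that by (intro mult_right_mono) auto
  then show ?thesis using that by simp
qed

text \<open>Without probes and with a constant published value, the answer is the same for both
  colors of the only key, hence wrong for one of them.\<close>

lemma hard_predecessor_base: "hard_predecessor 1 1 S w 0 1 (1 / 2)"
proof (rule hard_predecessorI)
  show "query_distribution {Red, Blue} {()} (\<lambda>_ _. 1)" by (auto simp: query_distribution_def)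
  show "hard {Red, Blue} {()} (\<lambda>_ _. 1) (\<lambda>y _. y) S w 0 1 (1 / 2)"
    unfolding hard_def
  proof (intro allI impI, elim conjE)
    fix M and \<pi> :: "color \<Rightarrow> nat list" and q
    assume q: "\<forall>y\<in>{Red, Blue}. \<forall>x\<in>{()}. set (probes (q (\<pi> y) x) (M y)) \<subseteq> {..<S} \<and> length (probes (q (\<pi> y) x) (M y)) \<le> 0"
      and B: "card (\<pi> ` {Red, Blue}) \<le> 1"
    have eq: "\<pi> Blue = \<pi> Red" using B by (auto simp: card_insert_if split: if_splits)
    have "probes (q (\<pi> Red) ()) (M Red) = []" using q by simp
    then obtain c where "q (\<pi> Red) () = Answer c" by (cases "q (\<pi> Red) ()") auto
    then show "1 / 2 \<le> error {Red, Blue} {()} (\<lambda>_ _. 1) (\<lambda>y _. y) M (\<lambda>y. q (\<pi> y))"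
      using eq by (cases c) (auto simp: error_def)
  qed
  show "encodes {Red, Blue} {()} (\<lambda>_ _. 1) (\<lambda>y _. y) 1 1 (\<lambda>c. [0 \<mapsto> c]) (\<lambda>_. 0)"
    by (auto simp: encodes_def intro!: pred_color_eqI)
qed

text \<open>The block number becomes the leading digit in base \<open>U\<close>. A query of nonzero
  weight has a predecessor inside its own block, and this exceeds all keys of earlier
  blocks.\<close>

lemma hard_predecessor_blocks:
  assumes "hard_predecessor n U S w t 1 e" and K: "K > 0" and \<tau>: "\<tau> > 0"
  shows "hard_predecessor (K * n) (K * U) S w t B (e - (ln B / (K * \<tau>) + \<tau>))"
proof -
  obtain I X :: "nat set" and \<omega> f enc num where qd: "query_distribution I X \<omega>"
    and hard: "hard I X \<omega> f S w t 1 e" and enc: "encodes I X \<omega> f n U enc num"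
    using assms by (auto simp: hard_predecessor_def)
  have "X \<noteq> {}" using qd by (simp add: query_distribution_def)
  then have U: "U > 0" using enc by (auto simp: encodes_def)
  define enc' where "enc' Y = (\<lambda>z. if z div U < K then enc (Y (z div U)) (z mod U) else None)" for Y :: "nat \<Rightarrow> nat"
  define num' where "num' = (\<lambda>(j, x). j * U + num x)"
  have "encodes (PiE {..<K} (\<lambda>_. I)) ({..<K} \<times> X) (\<lambda>Y (j, x). \<omega> (Y j) x / K) (\<lambda>Y (j, x). f (Y j) x)
    (K * n) (K * U) enc' num'"
    unfolding encodes_def
  proof (intro conjI ballI impI)
    fix Y assume Y: "Y \<in> PiE {..<K} (\<lambda>_. I)"
    show "dom (enc' Y) \<subseteq> {..<K * U}"
      using U by (auto simp: enc'_def div_less_iff_less_mult split: if_splits)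
    have bij: "bij_betw (\<lambda>(j, r). j * U + r) (SIGMA j:{..<K}. dom (enc (Y j))) (dom (enc' Y))"
    proof (rule bij_betw_byWitness[where f' = "\<lambda>z. (z div U, z mod U)"])
      have r: "r < U" if "enc (Y j) r = Some c" "j < K" for j r c
        using that enc Y unfolding encodes_def by (metis PiE_mem domI lessThan_iff subsetD)
      show "\<forall>a\<in>SIGMA j:{..<K}. dom (enc (Y j)).
        ((case a of (j, r) \<Rightarrow> j * U + r) div U, (case a of (j, r) \<Rightarrow> j * U + r) mod U) = a"
      proof
        fix a assume "a \<in> (SIGMA j:{..<K}. dom (enc (Y j)))"
        then obtain j b where "a = (j, b)" "b < U" using r by auto
        then show "((case a of (j, r) \<Rightarrow> j * U + r) div U, (case a of (j, r) \<Rightarrow> j * U + r) mod U) = a"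
          by simp
      qed
      show "(\<lambda>(j, r). j * U + r) ` (SIGMA j:{..<K}. dom (enc (Y j))) \<subseteq> dom (enc' Y)"
      proof
        fix z assume "z \<in> (\<lambda>(j, r). j * U + r) ` (SIGMA j:{..<K}. dom (enc (Y j)))"
        then obtain j b where z: "z = j * U + b" "j < K" "b \<in> dom (enc (Y j))" by auto
        moreover from z have "b < U" using r by auto
        ultimately show "z \<in> dom (enc' Y)" by (simp add: enc'_def dom_def)
      qed
    qed (use U in \<open>auto simp: enc'_def split: if_splits\<close>)
    have fin: "finite (dom (enc (Y j)))" "card (dom (enc (Y j))) = n" if "j < K" for j
    proof -
      have "Y j \<in> I" using Y that by auto
      then show "finite (dom (enc (Y j)))" "card (dom (enc (Y j))) = n"
        using enc finite_subset[of _ "{..<U}"] by (auto simp: encodes_def)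
    qed
    have "card (dom (enc' Y)) = (\<Sum>j<K. card (dom (enc (Y j))))"
      using bij_betw_same_card[OF bij, symmetric] fin by simp
    also have "\<dots> = K * n" using fin by simp
    finally show "card (dom (enc' Y)) = K * n" .
  next
    fix p assume "p \<in> {..<K} \<times> X"
    then obtain j x where "p = (j, x)" "j < K" "num x < U" using enc by (auto simp: encodes_def)
    then show "num' p < K * U" using mult_add_less[of j K "num x" U] by (simp add: num'_def)
  next
    fix Y p assume Y: "Y \<in> PiE {..<K} (\<lambda>_. I)" and "p \<in> {..<K} \<times> X"
      and "(case p of (j, x) \<Rightarrow> \<omega> (Y j) x / K) \<noteq> 0"
    then obtain j x where p: "p = (j, x)" "j < K" "x \<in> X" "\<omega> (Y j) x \<noteq> 0" by auto
    then have Yj: "Y j \<in> I" and numU: "num x < U" using Y enc by (auto simp: encodes_def)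
    then have "\<exists>z\<in>dom (enc (Y j)). z \<le> num x" and f: "pred_color (enc (Y j)) (num x) = f (Y j) x"
      using p enc by (auto simp: encodes_def)
    then obtain m c where m: "enc (Y j) m = Some c" "m \<le> num x"
      "\<And>z. z \<in> dom (enc (Y j)) \<Longrightarrow> z \<le> num x \<Longrightarrow> z \<le> m" "c = f (Y j) x"
      by (metis predecessorE)
    have key: "enc' Y (j * U + m) = Some c" using m numU p by (simp add: enc'_def)
    then show "\<exists>z\<in>dom (enc' Y). z \<le> num' p" using m p by (intro bexI[of _ "j * U + m"]) (auto simp: num'_def)
    have "z \<le> j * U + m" if z: "z \<in> dom (enc' Y)" "z \<le> j * U + num x" for z
    proof -
      have "z div U \<le> (j * U + num x) div U" using z by (intro div_le_mono)
      then have le: "z div U \<le> j" using numU by simp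
      show ?thesis
      proof (cases "z div U = j")
        case True
        then have "z = j * U + z mod U" by (metis div_mult_mod_eq)
        with z have "z mod U \<le> num x" by linarith
        moreover have "z mod U \<in> dom (enc (Y j))" using z(1) True p by (auto simp: enc'_def)
        ultimately have "z mod U \<le> m" using m(3) by blast
        then show ?thesis using \<open>z = j * U + z mod U\<close> by linarith
      next
        case False
        then have "(z div U + 1) * U \<le> j * U" using le by (intro mult_right_mono) auto
        moreover have "z < U + z div U * U" using U by (rule dividend_less_div_times)
        ultimately show ?thesis by simp
      qed
    qed
    then show "pred_color (enc' Y) (num' p) = (case p of (j, x) \<Rightarrow> f (Y j) x)"
      using key m p by (auto intro!: pred_color_eqI simp: num'_def)
  qed
  then show ?thesis
    using query_distribution_blocks[OF qd K] hard_blocks[OF qd hard K \<tau>] by (rule hard_predecessorI[rotated 2])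
qed

definition digits_value :: "nat \<Rightarrow> nat list \<Rightarrow> nat" where
  "digits_value U = foldl (\<lambda>a d. a * U + d) 0"

lemma digits_value_append: "digits_value U (xs @ ys) = digits_value U xs * U ^ length ys + digits_value U ys"
proof -
  have "foldl (\<lambda>a d. a * U + d) b ys = b * U ^ length ys + foldl (\<lambda>a d. a * U + d) 0 ys" for b
    by (induction ys rule: rev_induct) (auto simp: algebra_simps)
  from this[of "digits_value U xs"] show ?thesis by (simp add: digits_value_def)
qed

lemma digits_value_less: "set xs \<subseteq> {..<U} \<Longrightarrow> digits_value U xs < U ^ length xs"
proof (induction xs rule: rev_induct)
  case (snoc d xs)
  then show ?case using mult_add_less[of "digits_value U xs" "U ^ length xs" d U]
    by (simp add: digits_value_append mult.commute) (simp add: digits_value_def)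
qed (simp add: digits_value_def)

text \<open>A key is the prefix, one digit from the inner problem, and zeros. Against a query with
  the same prefix, the comparison is decided by the digit at position \<open>i\<close>: the zeros
  make the key the least string with that beginning, so the later query digits do not change the
  predecessor.\<close>

lemma hard_predecessor_prefix:
  assumes "hard_predecessor n U S w t (2 ^ (w * N)) e" and k: "k > 0" and R: "R \<ge> 1" "ln R > 1"
  shows "hard_predecessor n (U ^ k) S w (Suc t) 1
    (e - (2 * ln (real S + 1) / (k * (ln R - 1)) + (1 - 1 / (2 * R)) ^ N))"
proof -
  obtain I X :: "nat set" and \<omega> f enc num where qd: "query_distribution I X \<omega>"
    and hard: "hard I X \<omega> f S w t (2 ^ (w * N)) e" and enc: "encodes I X \<omega> f n U enc num"
    using assms by (auto simp: hard_predecessor_def)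
  have "X \<noteq> {}" using qd by (simp add: query_distribution_def)
  then have U: "U > 0" using enc by (auto simp: encodes_def)
  define num' where "num' xs = digits_value U (map num xs)" for xs
  define key where "key i z b = (num' (take i z) * U + b) * U ^ (k - i - 1)" for i z b
  define enc' where "enc' = (\<lambda>(i, z, y) h. if h mod U ^ (k - i - 1) = 0 \<and> h div U ^ (k - i - 1) div U = num' (take i z)
    then enc y (h div U ^ (k - i - 1) mod U) else None)"
  have numU: "num x < U" if "x \<in> X" for x using that enc by (simp add: encodes_def)
  have num'_less: "num' v < U ^ i" if "v \<in> tuples i X" for v i
    using that numU digits_value_less[of "map num v" U] by (auto simp: num'_def tuples_def subset_iff)
  have enc_key: "enc' (i, z, y) (key i z b) = enc y b" if "b < U" for i z y b
    using that U by (simp add: enc'_def key_def)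
  have key_less: "key i z b < U ^ k" if "i < k" "z \<in> tuples k X" "b < U" for i z b
  proof -
    have "num' (take i z) < U ^ i" using that take_tuples[of z k X i] by (intro num'_less) auto
    then have "num' (take i z) * U + b < U ^ i * U" using that by (intro mult_add_less)
    then have "key i z b < U ^ i * U * U ^ (k - i - 1)" using U by (simp add: key_def)
    also have "U ^ i * U * U ^ (k - i - 1) = U ^ (i + 1 + (k - i - 1))" by (simp add: power_add)
    also have "\<dots> = U ^ k" using that by simp
    finally show ?thesis .
  qed
  have domE: "\<exists>b\<in>dom (enc y). h = key i z b" if "h \<in> dom (enc' (i, z, y))" for h i z y
  proof -
    let ?b = "h div U ^ (k - i - 1) mod U"
    have "?b \<in> dom (enc y)" "h mod U ^ (k - i - 1) = 0" "h div U ^ (k - i - 1) div U = num' (take i z)"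
      using that by (auto simp: enc'_def split: if_splits)
    then have "h div U ^ (k - i - 1) = num' (take i z) * U + ?b" "h = h div U ^ (k - i - 1) * U ^ (k - i - 1)"
      by (metis div_mult_mod_eq, metis div_mult_mod_eq add_0_right)
    then have "h = key i z ?b" by (simp only: key_def)
    then show ?thesis using \<open>?b \<in> dom (enc y)\<close> by blast
  qed
  have "encodes ({..<k} \<times> tuples k X \<times> I) (tuples k X)
    (\<lambda>(i, z, y) x. of_bool (take i x = take i z) * \<omega> y (x ! i) / card X ^ (k - i - 1))
    (\<lambda>(i, z, y) x. f y (x ! i)) n (U ^ k) enc' num'"
    unfolding encodes_def
  proof (intro conjI ballI impI)
    fix p assume "p \<in> {..<k} \<times> tuples k X \<times> I"
    then obtain i z y where p: "p = (i, z, y)" "i < k" "z \<in> tuples k X" "y \<in> I" by auto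
    have dom: "dom (enc y) \<subseteq> {..<U}" "card (dom (enc y)) = n" using enc p by (auto simp: encodes_def)
    have eq: "dom (enc' p) = key i z ` dom (enc y)"
      using domE[of _ i z y] enc_key[of _ i z y] dom p by (fastforce simp: dom_def)
    have "inj (key i z)" using U by (auto simp: key_def inj_def)
    then show "card (dom (enc' p)) = n" using eq dom by (simp add: card_image inj_on_subset)
    show "dom (enc' p) \<subseteq> {..<U ^ k}" using eq key_less p dom by auto
  next
    fix x assume "x \<in> tuples k X"
    then show "num' x < U ^ k" by (rule num'_less)
  next
    fix p x assume "p \<in> {..<k} \<times> tuples k X \<times> I" and x: "x \<in> tuples k X"
      and "(case p of (i, z, y) \<Rightarrow> \<lambda>x. of_bool (take i x = take i z) * \<omega> y (x ! i) / card X ^ (k - i - 1)) x \<noteq> 0"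
    then obtain i z y where p: "p = (i, z, y)" "i < k" "z \<in> tuples k X" "y \<in> I"
      and pre: "take i x = take i z" "\<omega> y (x ! i) \<noteq> 0" by auto
    have xi: "x ! i \<in> X" using x p by (simp add: nth_tuples)
    have dom: "dom (enc y) \<subseteq> {..<U}" using enc p by (auto simp: encodes_def)
    have "\<exists>b\<in>dom (enc y). b \<le> num (x ! i)" and f: "pred_color (enc y) (num (x ! i)) = f y (x ! i)"
      using p pre xi enc by (auto simp: encodes_def)
    then obtain m c where m: "enc y m = Some c" "m \<le> num (x ! i)"
      "\<And>b. b \<in> dom (enc y) \<Longrightarrow> b \<le> num (x ! i) \<Longrightarrow> b \<le> m" "c = f y (x ! i)"
      by (metis predecessorE)
    have "x = take i x @ [x ! i] @ drop (Suc i) x"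
      using x p by (simp add: id_take_nth_drop tuples_def)
    then have "num' x = digits_value U (map num (take i x @ [x ! i] @ drop (Suc i) x))"
      by (simp add: num'_def)
    also have "\<dots> = (num' (take i z) * U + num (x ! i)) * U ^ (k - i - 1) + num' (drop (Suc i) x)"
      using x p unfolding pre(1) map_append digits_value_append num'_def
      by (simp add: tuples_def digits_value_def algebra_simps)
    finally have nx: "num' x = key i z (num (x ! i)) + num' (drop (Suc i) x)" by (simp add: key_def)
    have "drop (Suc i) x \<in> tuples (k - i - 1) X" using x by (auto simp: tuples_def dest: in_set_dropD)
    then have small: "num' (drop (Suc i) x) < U ^ (k - i - 1)" by (rule num'_less)
    have mono: "key i z b \<le> key i z b'" if "b \<le> b'" for b b' using that by (simp add: key_def)
    \<comment> \<open>A larger digit would lift the key by at least \<open>U ^ (k - i - 1)\<close>,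
      more than the later query digits can make up.\<close>
    have le_iff: "b \<le> num (x ! i)" if "key i z b \<le> num' x" for b
    proof (rule ccontr)
      assume "\<not> ?thesis"
      then have "key i z (num (x ! i) + 1) \<le> key i z b" by (intro mono) auto
      then show False using that nx small by (simp add: key_def algebra_simps)
    qed
    have k1: "enc' p (key i z m) = Some c" using enc_key[of m i z y] m dom p by auto
    have k2: "key i z m \<le> num' x" using mono[OF m(2)] nx by simp
    show "\<exists>h\<in>dom (enc' p). h \<le> num' x" using k1 k2 by blast
    show "pred_color (enc' p) (num' x) = (case p of (i, z, y) \<Rightarrow> \<lambda>x. f y (x ! i)) x"
    proof (rule pred_color_eqI[OF _ k2])
      show "enc' p (key i z m) = Some ((case p of (i, z, y) \<Rightarrow> \<lambda>x. f y (x ! i)) x)" using k1 m p by simp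
      fix h assume h: "h \<in> dom (enc' p)" "h \<le> num' x"
      then obtain b where b: "b \<in> dom (enc y)" "h = key i z b" using domE p by blast
      then show "h \<le> key i z m" using le_iff h m(3) mono by blast
    qed
  qed
  then show ?thesis
    using query_distribution_prefix[OF qd k] hard_prefix[OF qd hard k R] by (rule hard_predecessorI[rotated 2])
qed

section \<open>Iteration of the two constructions\<close>

fun universe :: "nat \<Rightarrow> nat \<Rightarrow> nat \<Rightarrow> nat" where
  "universe K k 0 = 1"
| "universe K k (Suc t) = (K * universe K k t) ^ k"

text \<open>The factor \<open>K\<close> on the left belongs to the induction because a round raises
  \<open>K * universe K k t\<close> to the power \<open>k\<close>. The base \<open>2 * k\<close>
  instead of \<open>k\<close> absorbs the one further factor \<open>K\<close> of each round.\<close>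

lemma universe_le:
  assumes "K > 0" "k > 0"
  shows "K * universe K k t \<le> K ^ ((2 * k) ^ t)"
proof (induction t)
  case (Suc t)
  have "K * universe K k (Suc t) \<le> K * (K ^ ((2 * k) ^ t)) ^ k"
    using Suc by (simp add: power_mono)
  also have "\<dots> = K ^ (1 + k * (2 * k) ^ t)" by (simp add: mult.commute flip: power_mult)
  also have "\<dots> \<le> K ^ ((2 * k) ^ Suc t)"
  proof (rule power_increasing)
    have "1 \<le> k * (2 * k) ^ t" using assms by simp
    then show "1 + k * (2 * k) ^ t \<le> (2 * k) ^ Suc t" by (simp add: mult.assoc)
  qed (use assms in simp)
  finally show ?case .
qed simp

text \<open>Blocks come first in each round: they lift hardness from one published value to
  \<open>2 ^ (w * N)\<close> values, which is what prefixes consume in exchange for one more probe.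
  The losses are \<open>?b\<close> for blocks and \<open>?a\<close> for prefixes.\<close>

lemma hard_predecessor_rounds:
  assumes "K > 0" "\<tau> > 0" "k > 0" "R \<ge> 1" "ln R > 1"
  shows "hard_predecessor (K ^ t) (universe K k t) S w t 1
    (1 / 2 - t * ((ln (2 ^ (w * N)) / (K * \<tau>) + \<tau>) + (2 * ln (real S + 1) / (k * (ln R - 1)) + (1 - 1 / (2 * R)) ^ N)))"
    (is "hard_predecessor _ _ _ _ _ _ (1 / 2 - real t * (?b + ?a))")
proof (induction t)
  case 0
  then show ?case using hard_predecessor_base by simp
next
  case (Suc t)
  have "hard_predecessor (K * K ^ t) ((K * universe K k t) ^ k) S w (Suc t) 1 ((1 / 2 - t * (?b + ?a) - ?b) - ?a)"
    using hard_predecessor_blocks[OF Suc assms(1,2), of "2 ^ (w * N)"] assms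
    by (intro hard_predecessor_prefix) simp_all
  moreover have "(1 / 2 - t * (x + y) - x) - y = 1 / 2 - Suc t * (x + y)" for x y :: real
    by (simp add: algebra_simps)
  ultimately show ?case by (simp only: universe.simps power_Suc)
qed

text \<open>Missing keys are added at \<open>U\<close> and above, out of reach of the queries below
  \<open>U\<close>. Randomness is removed separately for each query: the tables do not depend on it
  and the error is a sum over queries, so for each query some tree is as good as the
  average.\<close>

lemma hard_predecessor_error_le:
  assumes sol: "solves_colored_predecessor n l w S T D Q" and "hard_predecessor n' U S w T 1 e"
    and n: "n' \<le> n" "U + (n - n') \<le> 2 ^ l"
  shows "e \<le> 1 / 3"
proof -
  obtain I X :: "nat set" and \<omega> f enc num where qd: "query_distribution I X \<omega>"
    and hard: "hard I X \<omega> f S w T 1 e" and enc: "encodes I X \<omega> f n' U enc num"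
    using assms by (auto simp: hard_predecessor_def)
  have I: "finite I" "I \<noteq> {}" "finite X" "X \<noteq> {}" and nn: "\<And>y x. y \<in> I \<Longrightarrow> x \<in> X \<Longrightarrow> 0 \<le> \<omega> y x"
    and r: "\<And>y. y \<in> I \<Longrightarrow> (\<Sum>x\<in>X. \<omega> y x) = 1"
    using qd unfolding query_distribution_def by auto
  have table: "D Y i < 2 ^ w" if "Y \<in> colored_sets n l" "i < S" for Y i
    using sol that by (simp add: solves_colored_predecessor_def)
  have probes: "set (probes q (D Y)) \<subseteq> {..<S} \<and> length (probes q (D Y)) \<le> T"
    if "Y \<in> colored_sets n l" "x < 2 ^ l" "q \<in> set_pmf (Q x)" for Y x q
    using sol that by (simp add: solves_colored_predecessor_def)
  have prob: "measure_pmf.prob (Q x) {q. result q (D Y) \<noteq> pred_color Y x} \<le> 1 / 3"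
    if "Y \<in> colored_sets n l" "x < 2 ^ l" "\<exists>y\<in>dom Y. y \<le> x" for Y x
    using sol that by (simp add: solves_colored_predecessor_def)
  define enc' where "enc' y = (\<lambda>z. if z < U then enc y z else if z < U + (n - n') then Some Red else None)" for y
  have dom': "dom (enc' y) = dom (enc y) \<union> {U..<U + (n - n')}" if "y \<in> I" for y
    using that enc by (fastforce simp: enc'_def dom_def encodes_def split: if_splits)
  have sets: "enc' y \<in> colored_sets n l" if y: "y \<in> I" for y
  proof -
    have sub: "dom (enc y) \<subseteq> {..<U}" "card (dom (enc y)) = n'" using enc y by (auto simp: encodes_def)
    have "card (dom (enc' y)) = n' + (n - n')"
      unfolding dom'[OF y] using sub by (subst card_Un_disjoint) (auto intro: finite_subset)
    moreover have "dom (enc' y) \<subseteq> {..<2 ^ l}" unfolding dom'[OF y] using sub n by fastforce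
    ultimately show ?thesis using n by (simp add: colored_sets_def)
  qed
  have numU: "num x < U" "num x < 2 ^ l" if "x \<in> X" for x
    using that enc n by (auto simp: encodes_def intro: less_le_trans)
  have pred: "(\<exists>z\<in>dom (enc' y). z \<le> num x) \<and> pred_color (enc' y) (num x) = f y x"
    if "y \<in> I" "x \<in> X" "\<omega> y x \<noteq> 0" for y x
  proof -
    have "{z \<in> dom (enc' y). z \<le> num x} = {z \<in> dom (enc y). z \<le> num x}"
      using numU(1)[OF that(2)] dom'[OF that(1)] by auto
    moreover have ex: "\<exists>z\<in>dom (enc y). z \<le> num x" and f: "pred_color (enc y) (num x) = f y x"
      using that enc by (auto simp: encodes_def)
    moreover have "Max {z \<in> dom (enc y). z \<le> num x} < U"
    proof -
      have "finite {z \<in> dom (enc y). z \<le> num x}" by (rule finite_subset[of _ "{..num x}"]) auto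
      then have "Max {z \<in> dom (enc y). z \<le> num x} \<in> {z \<in> dom (enc y). z \<le> num x}"
        using ex by (intro Max_in) auto
      then show ?thesis using numU(1)[OF that(2)] by auto
    qed
    moreover have "\<exists>z\<in>dom (enc' y). z \<le> num x" using ex dom'[OF that(1)] by auto
    ultimately show ?thesis by (simp add: pred_color_def enc'_def)
  qed
  define loss where "loss x q = (\<Sum>y\<in>I. \<omega> y x * of_bool (result q (D (enc' y)) \<noteq> f y x))" for x q
  have "\<exists>q\<in>set_pmf (Q (num x)). loss x q \<le> (\<Sum>y\<in>I. \<omega> y x) / 3" if x: "x \<in> X" for x
  proof (rule ccontr)
    assume "\<not> ?thesis"
    then have gt: "AE q in measure_pmf (Q (num x)). (\<Sum>y\<in>I. \<omega> y x) / 3 < loss x q"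
      by (auto simp: AE_measure_pmf_iff not_le)
    have int: "integrable (measure_pmf (Q (num x))) (\<lambda>q. \<omega> y x * of_bool (result q (D (enc' y)) \<noteq> f y x))" for y
      by (intro integrable_mult_right measure_pmf.integrable_const_bound[where B = 1]) auto
    have "(\<Sum>y\<in>I. \<omega> y x) / 3 < measure_pmf.expectation (Q (num x)) (loss x)"
      by (rule measure_pmf.expectation_greater[OF _ gt]) (use int in \<open>auto simp: loss_def\<close>)
    also have "\<dots> = (\<Sum>y\<in>I. \<omega> y x * measure_pmf.prob (Q (num x)) {q. result q (D (enc' y)) \<noteq> f y x})"
    proof -
      have "measure_pmf.expectation (Q (num x)) (\<lambda>q. of_bool (result q (D (enc' y)) \<noteq> f y x))
        = measure_pmf.prob (Q (num x)) {q. result q (D (enc' y)) \<noteq> f y x}" for y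
      proof -
        have "(\<lambda>q. of_bool (result q (D (enc' y)) \<noteq> f y x)) = (indicator {q. result q (D (enc' y)) \<noteq> f y x} :: probe_tree \<Rightarrow> real)"
          by (auto simp: indicator_def)
        then show ?thesis by simp
      qed
      then show ?thesis unfolding loss_def by (subst Bochner_Integration.integral_sum[OF int]) simp
    qed
    also have "\<dots> \<le> (\<Sum>y\<in>I. \<omega> y x * (1 / 3))"
    proof (rule sum_mono)
      fix y assume y: "y \<in> I"
      show "\<omega> y x * measure_pmf.prob (Q (num x)) {q. result q (D (enc' y)) \<noteq> f y x} \<le> \<omega> y x * (1 / 3)"
      proof (cases "\<omega> y x = 0")
        case False
        then have "measure_pmf.prob (Q (num x)) {q. result q (D (enc' y)) \<noteq> pred_color (enc' y) (num x)} \<le> 1 / 3"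
          using prob[OF sets[OF y] numU(2)[OF x]] pred[OF y x] by simp
        then have "measure_pmf.prob (Q (num x)) {q. result q (D (enc' y)) \<noteq> f y x} \<le> 1 / 3"
          using pred[OF y x False] by simp
        then show ?thesis using nn[OF y x] by (intro mult_left_mono) auto
      qed simp
    qed
    finally show False by (simp add: sum_divide_distrib)
  qed
  then obtain q where q: "\<And>x. x \<in> X \<Longrightarrow> q x \<in> set_pmf (Q (num x))"
    "\<And>x. x \<in> X \<Longrightarrow> loss x (q x) \<le> (\<Sum>y\<in>I. \<omega> y x) / 3" by metis
  have "e \<le> error I X \<omega> f (\<lambda>y. D (enc' y)) (\<lambda>y. (\<lambda>_ x. q x) [])"
    by (rule hardD[OF hard, where \<pi> = "\<lambda>_. []"])
      (use table sets probes[OF sets numU(2) q(1)] I in \<open>auto simp: image_constant_conv\<close>)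
  also have "\<dots> = (\<Sum>x\<in>X. loss x (q x)) / card I"
    unfolding error_def loss_def by (subst sum.swap) simp
  also have "\<dots> \<le> (\<Sum>x\<in>X. (\<Sum>y\<in>I. \<omega> y x) / 3) / card I"
    using q(2) by (intro divide_right_mono sum_mono) auto
  also have "\<dots> = (\<Sum>y\<in>I. \<Sum>x\<in>X. \<omega> y x) / 3 / card I"
    by (subst sum.swap) (simp add: sum_divide_distrib)
  also have "\<dots> = 1 / 3" using r I by simp
  finally show ?thesis .
qed

section \<open>Choice of the parameters\<close>

text \<open>A round has four losses (two for blocks, one for information, one for sampling), each
  made at most \<open>\<tau> = 1 / (60 * T)\<close>. In total they are at most
  \<open>1 / 15\<close>, less than the gap \<open>1 / 2 - 1 / 3\<close>.\<close>

lemma round_parameters: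
  fixes n S w T k :: nat
  assumes T: "T > 0" "T \<le> w" and w: "w \<ge> 2" and n: "w ^ (92 * T) \<le> n"
    and k: "k > 0" "960 * real T ^ 2 * ln (real S + 1) / ln n \<le> k"
  shows "\<exists>K \<tau> R N. (K :: nat) > 0 \<and> (\<tau> :: real) > 0 \<and> (R :: real) \<ge> 1 \<and> ln R > 1 \<and> K ^ T \<le> n \<and>
    T * ((ln (2 ^ (w * N)) / (K * \<tau>) + \<tau>) + (2 * ln (real S + 1) / (k * (ln R - 1)) + (1 - 1 / (2 * R)) ^ N)) < 1 / 6"
proof -
  have npos: "n > 0" using n w zero_less_power[of w "92 * T"] by linarith
  have lnn: "92 * T * ln w \<le> ln n"
  proof -
    have "ln (real w ^ (92 * T)) \<le> ln n"
      using n w npos by (subst ln_le_cancel_iff) (auto simp flip: of_nat_power)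
    then show ?thesis using w by (simp add: ln_realpow)
  qed
  \<comment> \<open>The exponent \<open>92 = 4 * 23\<close> in the hypothesis gives
    \<open>w ^ 23 \<le> R\<close>. Then \<open>K \<le> R * w ^ 23 \<le> R\<^sup>2\<close>, so
    \<open>K ^ T\<close> is at most the square root of \<open>n\<close>.\<close>
  define R where "R = exp (ln n / (4 * T))"
  have lnR: "ln R = ln n / (4 * T)" by (simp add: R_def)
  have lnw: "ln w \<ge> 2 / 3"
  proof -
    have "ln 2 \<le> ln (real w)" using w by simp
    then show ?thesis using ln2_ge_two_thirds by linarith
  qed
  have "23 * ln w \<le> ln R" using lnn T by (simp add: lnR field_simps)
  then have lnR2: "ln R \<ge> 2" "23 * ln w \<le> ln R" using lnw by auto
  have lnn_pos: "ln n > 0" using lnR2 T by (simp add: lnR field_simps)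
  have R: "R \<ge> 1" using lnn_pos by (simp add: R_def)
  \<comment> \<open>This makes \<open>N / (2 * R) \<ge> 60 * T\<close>, so that sampling fails with
    probability at most \<open>exp (- (60 * T))\<close>.\<close>
  define N where "N = nat \<lceil>120 * R * T\<rceil>"
  have N: "120 * R * T \<le> N" "N \<le> 121 * R * T"
  proof -
    show "120 * R * T \<le> N" unfolding N_def by (rule real_nat_ceiling_ge)
    have "1 * 1 \<le> R * T" using R T by (intro mult_mono) auto
    moreover have "real N \<le> 120 * R * T + 1" using R by (simp add: N_def)
    ultimately show "N \<le> 121 * R * T" by simp
  qed
  have Npos: "N > 0" using N(1) R T by (cases N) (auto simp: mult_le_0_iff)
  \<comment> \<open>The choice means \<open>K * \<tau>\<^sup>2 = N * w\<close>, which balances the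
    two losses of the blocks.\<close>
  define K where "K = N * w * 3600 * T ^ 2"
  define \<tau> :: real where "\<tau> = 1 / (60 * T)"
  have K: "K > 0" using Npos w T by (simp add: K_def)
  have "K \<le> R * w ^ 23"
  proof -
    have "real K = N * (w * 3600 * real T ^ 2)" by (simp add: K_def)
    also have "\<dots> \<le> (121 * R * T) * (w * 3600 * real T ^ 2)" using N by (intro mult_right_mono) auto
    also have "\<dots> = R * (435600 * (w * real T ^ 3))" by (simp add: power2_eq_square power3_eq_cube)
    \<comment> \<open>The constant \<open>121 * 3600\<close> is below \<open>2 ^ 19\<close>;
      together with \<open>2 \<le> w\<close> and \<open>T \<le> w\<close> this yields the exponent
      \<open>19 + 4 = 23\<close>.\<close>
    also have "\<dots> \<le> R * (2 ^ 19 * (w * real w ^ 3))"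
      using R T by (intro mult_left_mono mult_mono power_mono) auto
    also have "\<dots> \<le> R * (real w ^ 19 * (w * real w ^ 3))"
      using R w by (intro mult_left_mono mult_right_mono power_mono) auto
    also have "\<dots> = R * w ^ 23" by (simp flip: power_Suc power_add)
    finally show ?thesis by simp
  qed
  then have "ln K \<le> ln (R * w ^ 23)" using K R w by (subst ln_le_cancel_iff) auto
  also have "\<dots> = ln R + 23 * ln w" using R w by (simp add: ln_mult ln_realpow)
  also have "\<dots> \<le> 2 * ln R" using lnR2 by simp
  also have "\<dots> = ln n / (2 * T)" by (simp add: lnR)
  finally have "T * ln K \<le> ln n" using T lnn_pos by (simp add: field_simps)
  then have "ln (real K ^ T) \<le> ln n" using K by (simp add: ln_realpow)
  then have KT: "K ^ T \<le> n" using K npos by (subst (asm) ln_le_cancel_iff) (auto simp flip: of_nat_power)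
  have e1: "ln (2 ^ (w * N)) / (K * \<tau>) \<le> \<tau>"
  proof -
    have "ln (2 ^ (w * N)) / (K * \<tau>) = ln 2 * \<tau>"
      using Npos w T by (simp add: K_def \<tau>_def ln_realpow power2_eq_square)
    also have "\<dots> \<le> 1 * \<tau>" using ln_2_less_1 by (intro mult_right_mono) (auto simp: \<tau>_def)
    finally show ?thesis by simp
  qed
  \<comment> \<open>Since \<open>ln R \<ge> 2\<close>, half of \<open>ln R\<close> remains after
    subtracting 1. The constant in the hypothesis on \<open>k\<close> is
    \<open>960 = 2 * 8 * 60\<close>.\<close>
  have e2: "2 * ln (real S + 1) / (k * (ln R - 1)) \<le> \<tau>"
  proof -
    have "2 * ln (real S + 1) / (k * (ln R - 1)) \<le> 2 * ln (real S + 1) / (k * (ln n / (8 * T)))"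
    proof -
      have "ln n / (8 * T) = ln R / 2" by (simp add: lnR)
      then show ?thesis using lnR2 k(1) by (intro divide_left_mono mult_left_mono mult_pos_pos) auto
    qed
    also have "\<dots> = (960 * real T ^ 2 * ln (real S + 1) / ln n) / (60 * T * k)"
      using T lnn_pos k by (simp add: field_simps power2_eq_square)
    also have "\<dots> \<le> k / (60 * T * k)" using k by (intro divide_right_mono) auto
    also have "\<dots> = \<tau>" using k by (simp add: \<tau>_def)
    finally show ?thesis .
  qed
  have e3: "(1 - 1 / (2 * R)) ^ N \<le> \<tau>"
  proof -
    have "(1 - 1 / (2 * R)) ^ N \<le> exp (- (1 / (2 * R))) ^ N"
      using R exp_ge_add_one_self[of "- (1 / (2 * R))"] by (intro power_mono) (auto simp: field_simps)
    also have "\<dots> = exp (- (N / (2 * R)))" by (simp flip: exp_of_nat_mult)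
    also have "\<dots> \<le> exp (- (60 * real T))" using N R by (simp add: field_simps)
    also have "\<dots> = 1 / exp (60 * real T)" by (simp add: exp_minus field_simps)
    also have "\<dots> \<le> \<tau>"
    proof -
      have "60 * real T \<le> exp (60 * real T)" using exp_ge_add_one_self[of "60 * real T"] by linarith
      then show ?thesis unfolding \<tau>_def using T by (intro divide_left_mono) auto
    qed
    finally show ?thesis .
  qed
  have "T * ((ln (2 ^ (w * N)) / (K * \<tau>) + \<tau>) + (2 * ln (real S + 1) / (k * (ln R - 1)) + (1 - 1 / (2 * R)) ^ N))
    \<le> T * ((\<tau> + \<tau>) + (\<tau> + \<tau>))"
    by (intro mult_left_mono add_mono e1 e2 e3) auto
  also have "\<dots> < 1 / 6" using T by (simp add: \<tau>_def)
  finally show ?thesis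
    using K R lnR2 KT T by (intro exI[of _ K] exI[of _ \<tau>] exI[of _ R] exI[of _ N]) (auto simp: \<tau>_def)
qed

text \<open>Since \<open>K \<le> n\<close>, the universe is at most
  \<open>n ^ ((2 * k) ^ T)\<close>; the summand 1 in the bound on \<open>l\<close> is the bit that
  makes room for the padding keys. After \<open>T\<close> rounds the error still exceeds
  \<open>1 / 2 - 1 / 6\<close>.\<close>

lemma no_fast_solution:
  assumes sol: "solves_colored_predecessor n l w S T D Q"
    and T: "T > 0" "T \<le> w" and w: "w \<ge> 2" and n: "w ^ (92 * T) \<le> n"
    and k: "k > 0" "960 * real T ^ 2 * ln (real S + 1) / ln n \<le> real k"
    and l: "1 + real (2 * k) ^ T * log 2 n \<le> l"
  shows False
proof -
  obtain K \<tau> R N where K: "(K :: nat) > 0" "(\<tau> :: real) > 0" "(R :: real) \<ge> 1" "ln R > 1" "K ^ T \<le> n"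
    and err: "T * ((ln (2 ^ (w * N)) / (K * \<tau>) + \<tau>) +
      (2 * ln (real S + 1) / (k * (ln R - 1)) + (1 - 1 / (2 * R)) ^ N)) < 1 / 6"
    using round_parameters[OF T w n k] by blast
  have npos: "n > 0" using K(1,5) zero_less_power[of K T] by linarith
  have "K ^ 1 \<le> K ^ T" using K(1) T by (intro power_increasing) auto
  then have "K \<le> n" using K(5) by simp
  have "universe K k T \<le> K * universe K k T" using K(1) by simp
  also have "\<dots> \<le> K ^ ((2 * k) ^ T)" using K(1) k(1) by (rule universe_le)
  also have "\<dots> \<le> n ^ ((2 * k) ^ T)" using \<open>K \<le> n\<close> by (rule power_mono) simp
  finally have U: "universe K k T \<le> n ^ ((2 * k) ^ T)" .
  have "n ^ 1 \<le> n ^ ((2 * k) ^ T)" using npos k(1) by (intro power_increasing) auto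
  then have "universe K k T + (n - K ^ T) \<le> 2 * n ^ ((2 * k) ^ T)" using U by simp
  also have "\<dots> \<le> 2 ^ l"
  proof -
    define m where "m = (2 * k) ^ T"
    have "2 powr (log 2 n * real m) = real n ^ m"
      using npos by (simp add: powr_realpow flip: powr_powr)
    then have "real (2 * n ^ ((2 * k) ^ T)) = 2 powr (1 + real (2 * k) ^ T * log 2 n)"
      by (simp add: powr_add m_def mult.commute)
    also have "\<dots> \<le> 2 powr l" using l by (intro powr_mono) auto
    also have "\<dots> = real (2 ^ l)" by (simp add: powr_realpow)
    finally show ?thesis by (simp only: of_nat_le_iff)
  qed
  finally have "universe K k T + (n - K ^ T) \<le> 2 ^ l" .
  then show False
    using hard_predecessor_error_le[OF sol hard_predecessor_rounds[OF K(1,2) k(1) K(3,4), of T S w N] K(5)] err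
    by simp
qed

section \<open>From logarithmic bounds to the asymptotic statement\<close>

lemma lg_ge: "log 2 (x + 2) \<le> lg x" and lg_le: "lg x \<le> log 2 (x + 2) + 1"
  unfolding lg_def by linarith+

lemma lg_ge_2: "x > 0 \<Longrightarrow> lg x \<ge> 2"
proof -
  assume "x > 0"
  then have "log 2 2 < log 2 (x + 2)" by (subst log_less_cancel_iff) auto
  then have "1 < \<lceil>log 2 (x + 2)\<rceil>" by (simp add: less_ceiling_iff)
  then show ?thesis by (simp add: lg_def)
qed

lemma log_le_lg: "x > 0 \<Longrightarrow> log 2 x \<le> lg x"
  using lg_ge[of x] log_le_cancel_iff[of 2 x "x + 2"] by linarith

theorem theorem1:
  fixes c\<^sub>a c\<^sub>w :: real
  assumes "c\<^sub>a > 0" and "c\<^sub>w > 0"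
  shows "\<exists>C>0. \<forall>(n::nat) (l::nat) (w::nat) (a::real) (S::nat) (T::nat) D Q.
    n \<ge> 1 \<and> lg (real n) \<le> real l \<and> l \<le> w \<and> real w \<ge> c\<^sub>w * lg (real n) \<and>
    a \<ge> c\<^sub>a * lg (real n) \<and> real S \<le> real n * 2 powr a \<and>
    solves_colored_predecessor n l w S T D Q \<longrightarrow>
    real T \<ge> C * min (log (real w) (real n))
                     (lg (real l / a) / (lg (lg (real l / a)) + lg (a / lg (real n))))"
proof -
  \<comment> \<open>Chosen for \<open>k \<le> c1 * T\<^sup>2 * \<rho>\<close>. The first summand
    pays for rounding \<open>k\<close> up, as \<open>\<rho> \<ge> c\<^sub>a\<close>; in the second,
    \<open>2880 = 3 * 960\<close> because of \<open>g \<le> 3 * ln n\<close>, and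
    \<open>1 + 2 / c\<^sub>a\<close> comes from \<open>ln (S + 1)\<close> in terms of
    \<open>a\<close>.\<close>
  define c1 where "c1 = 2 / c\<^sub>a + 2880 * (1 + 2 / c\<^sub>a)"
  define c2 where "c2 = max 0 (log 2 (2 * c1))"
  define c3 where "c3 = max 0 (log 2 (2 / c\<^sub>a))"
  \<comment> \<open>The three bounds yield \<open>w ^ (92 * T) \<le> n\<close>, then
    \<open>T * log 2 (2 * k) \<le> L / 4\<close>, and finally \<open>L > 4 + 2 * c3\<close> by way
    of \<open>1 \<le> T * \<Delta> < C * L\<close>.\<close>
  define C where "C = min (1 / 92) (min (1 / (4 * (c2 + 2))) (1 / (4 + 2 * c3)))"
  have c1: "c1 > 0" using assms by (simp add: c1_def add_pos_pos)
  have c2: "c2 \<ge> 0" "log 2 (2 * c1) \<le> c2" and c3: "c3 \<ge> 0" "log 2 (2 / c\<^sub>a) \<le> c3"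
    by (simp_all add: c2_def c3_def)
  have C: "C > 0" "C \<le> 1 / 92" "C \<le> 1 / (4 * (c2 + 2))" "C \<le> 1 / (4 + 2 * c3)"
    using c2 c3 by (auto simp: C_def)
  have "real T \<ge> C * min (log (real w) (real n))
      (lg (real l / a) / (lg (lg (real l / a)) + lg (a / lg (real n))))"
    if n: "n \<ge> 1" and l: "lg (real n) \<le> real l" "l \<le> w"
      and a: "a \<ge> c\<^sub>a * lg (real n)" and S: "real S \<le> real n * 2 powr a"
      and sol: "solves_colored_predecessor n l w S T D Q"
    for n l w S T :: nat and a :: real and D Q
  proof (rule ccontr)
    assume "\<not> ?thesis"
    then have less: "real T < C * min (log (real w) (real n))
        (lg (real l / a) / (lg (lg (real l / a)) + lg (a / lg (real n))))"
      by simp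
    define g where "g = lg (real n)"
    define \<rho> where "\<rho> = a / g"
    define L where "L = lg (real l / a)"
    define \<Delta> where "\<Delta> = lg L + lg \<rho>"
    have g: "g \<ge> 2" "log 2 n \<le> g" "g \<le> l" "g \<le> w"
      using n l lg_ge_2[of n] log_le_lg[of n] by (auto simp: g_def)
    have "c\<^sub>a * g \<le> a" using a by (simp add: g_def)
    moreover have "0 < c\<^sub>a * g" using assms g by simp
    ultimately have apos: "a > 0" by linarith
    have ga: "g \<le> a / c\<^sub>a" and \<rho>: "\<rho> \<ge> c\<^sub>a"
      using \<open>c\<^sub>a * g \<le> a\<close> assms g by (auto simp: \<rho>_def field_simps)
    have \<rho>pos: "\<rho> > 0" using \<rho> assms by simp
    have lpos: "real l > 0" using g by linarith
    have L2: "L \<ge> 2" unfolding L_def using apos lpos by (intro lg_ge_2) auto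
    have \<Delta>: "\<Delta> \<ge> 4" using lg_ge_2[of L] lg_ge_2[of \<rho>] L2 \<rho>pos by (simp add: \<Delta>_def)
    have less1: "T < C * log w n" and less2: "T < C * (L / \<Delta>)"
    proof -
      have "C * min x y \<le> C * x" "C * min x y \<le> C * y" for x y using C(1) by (auto intro: mult_left_mono)
      then show "T < C * log w n" "T < C * (L / \<Delta>)"
        using less unfolding \<Delta>_def \<rho>_def L_def g_def by (meson less_le_trans)+
    qed
    have w2: "w \<ge> 2" using g by linarith
    have n2l: "n + 2 \<le> 2 ^ l"
    proof -
      have "log 2 (real n + 2) \<le> l" using lg_ge[of n] l by simp
      then have "real n + 2 \<le> 2 powr l" by (subst (asm) log_le_iff) auto
      then have "real (n + 2) \<le> real (2 ^ l)" by (simp add: powr_realpow)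
      then show ?thesis by (simp only: of_nat_le_iff)
    qed
    show False
    proof (cases "T = 0")
      \<comment> \<open>Without probes the padded one-key problem already forces an error of
        \<open>1 / 2\<close>.\<close>
      case True
      then show False using hard_predecessor_error_le[OF sol[unfolded True] hard_predecessor_base n] n2l n by simp
    next
      case False
      then have T: "T > 0" by simp
      have lognn: "log w n \<le> log 2 n"
      proof -
        have "ln 2 \<le> ln (real w)" using w2 by simp
        moreover have "0 < ln (real w)" using w2 by simp
        ultimately show ?thesis unfolding log_def using n by (intro divide_left_mono mult_pos_pos) auto
      qed
      have logn0: "0 \<le> log w n" using n w2 by (simp add: zero_le_log_cancel_iff)
      have "C * log w n \<le> 1 / 92 * log w n" using C(2) logn0 by (rule mult_right_mono)
      then have T92: "real (92 * T) \<le> log w n" using less1 by simp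
      then have "T \<le> w" using lognn g T by linarith
      have wn: "w ^ (92 * T) \<le> n"
      proof -
        have "w powr real (92 * T) \<le> n" using T92 w2 n by (subst (asm) le_log_iff) auto
        then have "real (w ^ (92 * T)) \<le> real n" using powr_realpow[of w "92 * T"] w2 by simp
        then show ?thesis by (simp only: of_nat_le_iff)
      qed
      have n4: "n \<ge> 4"
      proof -
        have "2 ^ 2 \<le> w ^ (92 * T)" using w2 T by (intro order_trans[OF power_mono[of 2 w 2] power_increasing]) auto
        then show ?thesis using wn by simp
      qed
      have lnn: "g \<le> 3 * ln n" "ln n \<le> g" "ln n > 0"
      proof -
        have log2n: "log 2 n \<ge> 2" using n4 by (subst le_log_iff) auto
        have "log 2 (real n + 2) \<le> log 2 (2 * n)" using n4 by (subst log_le_cancel_iff) auto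
        also have "\<dots> = 1 + log 2 n" using n by (simp add: log_mult)
        finally have "g \<le> 2 * log 2 n" using lg_le[of n] log2n by (simp add: g_def)
        also have "log 2 n = ln n / ln 2" by (simp add: log_def)
        also have "2 * (ln n / ln 2) \<le> 3 * ln n"
        proof -
          have "ln n * 2 \<le> ln n * (3 * ln 2)" using ln2_ge_two_thirds n by (intro mult_left_mono) auto
          then show ?thesis by (simp add: field_simps)
        qed
        finally show "g \<le> 3 * ln n" .
        then show "ln n > 0" using g by linarith
        then have "ln n * ln 2 \<le> ln n * 1" using ln_2_less_1 by (intro mult_left_mono) auto
        then have "ln n \<le> log 2 n" by (simp add: log_def field_simps)
        then show "ln n \<le> g" using g by linarith
      qed
      define k where "k = nat \<lceil>960 * real T ^ 2 * ln (real S + 1) / ln n\<rceil> + 1"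
      have k: "k > 0" "960 * real T ^ 2 * ln (real S + 1) / ln n \<le> real k"
        by (simp_all add: k_def, linarith)
      have T1: "1 \<le> real T ^ 2" using T by simp
      have k_le: "real (2 * k) \<le> 2 * c1 * real T ^ 2 * \<rho>"
      proof -
        have "real S + 1 \<le> n * 2 powr a + n * 2 powr a"
          using S n apos mult_mono[of 1 "real n" 1 "2 powr a"] by (simp add: ge_one_powr_ge_zero)
        then have "ln (real S + 1) \<le> ln (2 * (n * 2 powr a))" by (subst ln_le_cancel_iff) (use n in auto)
        also have "\<dots> = ln 2 + ln n + a * ln 2" using n by (simp add: ln_mult ln_powr)
        also have "\<dots> \<le> g + g + a * 1"
          using ln_2_less_1 g lnn apos by (intro add_mono mult_left_mono) auto
        also have "\<dots> \<le> a + 2 * (a / c\<^sub>a)" using ga by simp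
        also have "\<dots> = (1 + 2 / c\<^sub>a) * a" by (simp add: algebra_simps)
        finally have lnS: "ln (real S + 1) \<le> (1 + 2 / c\<^sub>a) * a" .
        have "960 * real T ^ 2 * ln (real S + 1) / ln n \<le> 960 * real T ^ 2 * ((1 + 2 / c\<^sub>a) * a) / (g / 3)"
          using lnS lnn g assms apos by (intro frac_le mult_left_mono) auto
        also have "\<dots> = 2880 * (1 + 2 / c\<^sub>a) * (real T ^ 2 * \<rho>)" by (simp add: \<rho>_def)
        finally have 1: "960 * real T ^ 2 * ln (real S + 1) / ln n \<le> 2880 * (1 + 2 / c\<^sub>a) * (real T ^ 2 * \<rho>)" .
        have "0 \<le> 960 * real T ^ 2 * ln (real S + 1) / ln n" using lnn by simp
        then have "real k \<le> 960 * real T ^ 2 * ln (real S + 1) / ln n + 2" unfolding k_def by linarith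
        moreover have "1 * c\<^sub>a \<le> real T ^ 2 * \<rho>" using T1 \<rho> assms by (intro mult_mono) auto
        then have "2 \<le> 2 / c\<^sub>a * (real T ^ 2 * \<rho>)" using assms by (simp add: field_simps)
        moreover have "c1 * (real T ^ 2 * \<rho>) = 2 / c\<^sub>a * (real T ^ 2 * \<rho>) + 2880 * (1 + 2 / c\<^sub>a) * (real T ^ 2 * \<rho>)"
          unfolding c1_def by (rule distrib_right)
        ultimately have "real k \<le> c1 * (real T ^ 2 * \<rho>)" using 1 by linarith
        then show ?thesis by simp
      qed
      have TC: "T * \<Delta> < C * L" using less2 \<Delta> by (simp add: field_simps)
      \<comment> \<open>The factor \<open>T\<^sup>2\<close> in \<open>k\<close> adds
        \<open>2 * log 2 T\<close> to the logarithm of \<open>k\<close>; this bound lets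
        \<open>lg L\<close>, a part of \<Delta>, cover it.\<close>
      have TL: "T \<le> L"
      proof -
        have "real T * 1 \<le> real T * \<Delta>" using \<Delta> by (intro mult_left_mono) auto
        moreover have "C * L \<le> 1 * L" using C(2) L2 by (intro mult_right_mono) auto
        ultimately show ?thesis using TC by linarith
      qed
      have big: "4 + 2 * c3 < L"
      proof -
        have "1 * 1 \<le> real T * \<Delta>" using T \<Delta> by (intro mult_mono) auto
        then have "1 < C * L" using TC by simp
        also have "\<dots> \<le> 1 / (4 + 2 * c3) * L" using C(4) L2 by (intro mult_right_mono) auto
        finally show ?thesis using c3 by (simp add: field_simps)
      qed
      have "log 2 (real (2 * k)) \<le> (c2 + 2) * \<Delta>"
      proof -
        have "log 2 (real (2 * k)) \<le> log 2 (2 * c1 * real T ^ 2 * \<rho>)"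
          using k_le k(1) T c1 \<rho>pos by (subst log_le_cancel_iff) auto
        also have "\<dots> = log 2 (2 * c1) + 2 * log 2 T + log 2 \<rho>"
          using c1 T \<rho>pos by (simp add: log_mult log_nat_power)
        also have "\<dots> \<le> c2 + 2 * lg L + lg \<rho>"
        proof -
          have "log 2 T \<le> log 2 L" using TL T by (subst log_le_cancel_iff) auto
          then show ?thesis using c2 log_le_lg[of L] log_le_lg[OF \<rho>pos] L2 by simp
        qed
        also have "\<dots> \<le> c2 * \<Delta> + 2 * \<Delta>"
          using mult_left_mono[of 1 \<Delta> c2] c2 \<Delta> lg_ge_2[OF \<rho>pos] by (simp add: \<Delta>_def)
        finally show ?thesis by (simp add: algebra_simps)
      qed
      then have "T * log 2 (real (2 * k)) \<le> T * ((c2 + 2) * \<Delta>)" by (intro mult_left_mono) auto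
      also have "\<dots> = (c2 + 2) * (T * \<Delta>)" by simp
      also have "\<dots> \<le> (c2 + 2) * (C * L)" using TC c2 by (intro mult_left_mono) auto
      also have "\<dots> \<le> (c2 + 2) * (1 / (4 * (c2 + 2)) * L)"
        using C(3) L2 c2 by (intro mult_left_mono mult_right_mono) auto
      also have "\<dots> = L / 4"
      proof -
        have "d * (1 / (4 * d) * L) = L / 4" if "d \<noteq> 0" for d :: real using that by simp
        from this[of "c2 + 2"] show ?thesis using c2(1) by linarith
      qed
      finally have Tk: "T * log 2 (real (2 * k)) \<le> L / 4" .
      \<comment> \<open>One unit is lost by rounding up, the other by the summand 2 inside
        \<open>lg\<close>, which is harmless as \<open>L\<close> is large enough to force
        \<open>l / a > 6\<close>.\<close>
      have L_le: "L \<le> 2 + log 2 (l / a)"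
      proof -
        have "3 < log 2 (l / a + 2)" using lg_le[of "l / a"] big c3 by (simp add: L_def)
        then have "2 powr 3 < l / a + 2" using apos lpos by (subst (asm) less_log_iff) (auto simp: add_pos_pos)
        then have "log 2 (l / a + 2) \<le> log 2 (2 * (l / a))" by (subst log_le_cancel_iff) auto
        also have "\<dots> = 1 + log 2 (l / a)" using apos lpos by (subst log_mult) auto
        finally show ?thesis using lg_le[of "l / a"] by (simp add: L_def)
      qed
      \<comment> \<open>Division by \<open>c\<^sub>a\<close> replaces \<open>a\<close> by a bound on
        \<open>g\<close>; the factor 2 leaves room for the summand 1 in the required bound on
        \<open>l\<close>.\<close>
      have "log 2 (real (2 * k) ^ T * (2 / c\<^sub>a)) = T * log 2 (real (2 * k)) + log 2 (2 / c\<^sub>a)"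
      proof -
        have "log 2 (real (2 * k) ^ T) = T * log 2 (real (2 * k))" using k(1) by (intro log_nat_power) simp
        then show ?thesis using k(1) assms by (subst log_mult) auto
      qed
      \<comment> \<open>From \<open>L > 4 + 2 * c3\<close> it follows that
        \<open>L / 4 + c3 \<le> L - 2\<close>.\<close>
      also have "\<dots> \<le> log 2 (l / a)" using Tk c3 L_le big by linarith
      finally have "real (2 * k) ^ T * (2 / c\<^sub>a) \<le> l / a"
        using k(1) assms apos lpos by (subst (asm) log_le_cancel_iff) auto
      then have bound: "2 * (real (2 * k) ^ T * (a / c\<^sub>a)) \<le> l" using apos by (simp add: field_simps)
      have "1 * 1 \<le> real (2 * k) ^ T * g" using k(1) g by (intro mult_mono one_le_power) auto
      moreover have "real (2 * k) ^ T * log 2 n \<le> real (2 * k) ^ T * g" using g by (intro mult_left_mono) auto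
      moreover have "real (2 * k) ^ T * g \<le> real (2 * k) ^ T * (a / c\<^sub>a)" using ga by (intro mult_left_mono) auto
      ultimately have "1 + real (2 * k) ^ T * log 2 n \<le> l" using bound by linarith
      then show False using no_fast_solution[OF sol T \<open>T \<le> w\<close> w2 wn k] by simp
    qed
  qed
  then show ?thesis using C(1) by (intro exI[of _ C]) blast
qed

end
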